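(* Let $\beta,\gamma_0,\gamma$ satisfy $0<\beta<\frac{\pi}{2}$, $0<\gamma_0<2\sin\left(\frac{\beta}{2}\right)$ and $\gamma=2\arcsin\left(\frac{\gamma_0}{2}\right)<\beta$. Suppose that there exists an index $i_*\in[N]$ such that $R_{i_*}^0\in B_{\gamma_0}$, and that $$\kappa>\kappa_c(\gamma):=\frac{N\max_{j\in[N]}\|\Omega_j\|}{\sin\left(2\sin\frac{\gamma}{2}\right)\tilde I(\gamma)},\qquad R_i^0\in B_{\Gamma_i(\gamma)}\quad\text{for all } i\in[N],$$ where $$\Gamma_i(\gamma):=\sqrt{2+2\sqrt{1-\frac{N^2\|\Omega_i\|^2}{\kappa^2\tilde I(\gamma)^2}}}.$$ Let $\{R_i\}_{i=1}^N$ be the global solution to the Winfree matrix model on $SO(n)$ (see context). Then $$\limsup_{t\to\infty}d(I_n,R_i(t))\le 2\arcsin\left[\frac12\arcsin\left(\frac{N\|\Omega_i\|}{\kappa\tilde I(\gamma)}\right)\right]\quad\text{for all } i\in[N].$$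
   Context: Let $[N]=\{1,\dots,N\}$, let $I_n$ be the $n\times n$ identity matrix, and let $\mathfrak{so}(n)$ be the space of real skew-symmetric $n\times n$ matrices. On $\mathbb{R}^{n\times n}$ use $\langle A,B\rangle=\frac12\operatorname{tr}(A^TB)$ and $\|A\|=\sqrt{\langle A,A\rangle}$. Let $d$ be the geodesic (Riemannian) distance on $SO(n)$ for the metric $\langle\cdot,\cdot\rangle$ restricted to tangent spaces; if $R\in SO(n)$ has eigenvalues $e^{\pm \mathrm{i}\theta_1},\dots,e^{\pm\mathrm{i}\theta_m},1,\dots,1$ with $\theta_j\in(0,\pi]$, then $d(I_n,R)=\sqrt{\sum_j\theta_j^2}$. Put $B_r=\{R\in SO(n): d(I_n,R)<r\}$. The Winfree matrix model on $SO(n)$ is $$\dot R_i=\Omega_iR_i+\frac{\kappa}{2}\Big(\frac1N\sum_{j=1}^N I(R_j)\Big)(I_n-R_i^2),\quad t>0,\qquad R_i(0)=R_i^0\in SO(n),\quad i\in[N],$$ with $\Omega_i\in\mathfrak{so}(n)$ and $\kappa>0$. Standing assumptions on the influence function $I$: $I(R)=\tilde I(d(I_n,R))$ for a function $\tilde I:[0,\lfloor n/2\rfloor\pi]\to\mathbb{R}_{\ge0}$ that is decreasing (non-increasing), satisfies $\lim_{r\to0^+}\tilde I(r)=1$, is globally Lipschitz continuous, and has support $\operatorname{supp}\tilde I=[0,\beta]$ with $0<\beta<\frac{\pi}{2}$. *)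

theory Defs
  imports "HOL-Analysis.Analysis"
begin

definition SO :: "(real^'n^'n) set" where
  "SO = {R. rotation_matrix R}"

definition skew_matrices :: "(real^'n^'n) set" where
  "skew_matrices = {A. transpose A = - A}"

text \<open>The inner product carries a factor \<open>1/2\<close>, so the norm below is not the library
  norm of \<open>real^'n^'n\<close> (the Frobenius norm).\<close>

definition mat_inner :: "real^'n^'n \<Rightarrow> real^'n^'n \<Rightarrow> real" where
  "mat_inner A B = trace (transpose A ** B) / 2"

definition mat_norm :: "real^'n^'n \<Rightarrow> real" where
  "mat_norm A = sqrt (mat_inner A A)"

text \<open>Riemannian distance: infimum of the lengths of the piecewise \<open>C\<^sup>1\<close> curves in
  \<open>SO\<close> joining two points. The library's \<open>valid_path\<close> allows the derivative to be
  unbounded near the finitely many exceptional parameters, and the \<open>integral\<close> of a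
  non-integrable function is \<open>0\<close> by convention; \<open>has_integral\<close> therefore
  restricts the infimum to curves whose length actually exists.\<close>

definition SO_dist :: "real^'n^'n \<Rightarrow> real^'n^'n \<Rightarrow> real" where
  "SO_dist P Q = Inf {L. \<exists>g. valid_path g \<and> path_image g \<subseteq> SO \<and>
     pathstart g = P \<and> pathfinish g = Q \<and>
     ((\<lambda>t. mat_norm (vector_derivative g (at t))) has_integral L) {0..1}}"

definition SO_ball :: "real \<Rightarrow> (real^'n^'n) set" where
  "SO_ball r = {R \<in> SO. SO_dist (mat 1) R < r}"

text \<open>The profile is a function on \<open>[0, \<lfloor>n/2\<rfloor>\<pi>]\<close>; nothing is required
  of the values of the total function \<open>f\<close> outside this interval.\<close>

definition influence_profile :: "nat \<Rightarrow> real \<Rightarrow> (real \<Rightarrow> real) \<Rightarrow> bool" where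
  "influence_profile n \<beta> f \<longleftrightarrow>
     (let D = {0..real (n div 2) * pi} in
       (\<forall>r\<in>D. 0 \<le> f r) \<and>
       antimono_on D f \<and>
       (f \<longlongrightarrow> 1) (at_right 0) \<and>
       (\<exists>L. L-lipschitz_on D f) \<and>
       closure {r \<in> D. f r \<noteq> 0} = {0..\<beta>})"

definition influence :: "(real \<Rightarrow> real) \<Rightarrow> real^'n^'n \<Rightarrow> real" where
  "influence f R = f (SO_dist (mat 1) R)"

text \<open>A product is written \<open>R ** R\<close> since the power operator on \<open>real^'n^'n\<close>
  is componentwise.\<close>

definition winfree_solution ::
  "nat \<Rightarrow> real \<Rightarrow> (real \<Rightarrow> real) \<Rightarrow> (nat \<Rightarrow> real^'n^'n) \<Rightarrow> (nat \<Rightarrow> real^'n^'n)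
     \<Rightarrow> (nat \<Rightarrow> real \<Rightarrow> real^'n^'n) \<Rightarrow> bool" where
  "winfree_solution N \<kappa> f \<Omega> R0 R \<longleftrightarrow>
     (\<forall>i\<in>{1..N}.
        R i 0 = R0 i \<and>
        continuous_on {0..} (R i) \<and>
        (\<forall>t\<ge>0. R i t \<in> SO) \<and>
        (\<forall>t>0. (R i has_vector_derivative
            \<Omega> i ** R i t +
            (\<kappa> / 2 * (1 / real N * (\<Sum>j=1..N. influence f (R j t))))
              *\<^sub>R (mat 1 - R i t ** R i t)) (at t)))"

definition kappa_c :: "nat \<Rightarrow> (real \<Rightarrow> real) \<Rightarrow> (nat \<Rightarrow> real^'n^'n) \<Rightarrow> real \<Rightarrow> real" where
  "kappa_c N f \<Omega> \<gamma> =
     real N * Max ((\<lambda>j. mat_norm (\<Omega> j)) ` {1..N}) / (sin (2 * sin (\<gamma> / 2)) * f \<gamma>)"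

definition Gam :: "nat \<Rightarrow> real \<Rightarrow> (real \<Rightarrow> real) \<Rightarrow> real^'n^'n \<Rightarrow> real \<Rightarrow> real" where
  "Gam N \<kappa> f A \<gamma> =
     sqrt (2 + 2 * sqrt (1 - (real N)\<^sup>2 * (mat_norm A)\<^sup>2 / (\<kappa>\<^sup>2 * (f \<gamma>)\<^sup>2)))"

end

theory Submission
  imports Defs
begin

text \<open>Write \<open>F R = n - trace R\<close> for the squared chordal distance of \<open>R\<close> to the identity (in the
  norm with the factor \<open>1/2\<close>) and \<open>q R = sqrt (n - trace (R\<^sup>2))\<close>. Along the flow, \<open>F' \<le> q (\<parallel>\<Omega>\<^sub>i\<parallel> - K q / 2)\<close>
  with \<open>K = \<kappa> I \<gamma> / N\<close> as long as \<open>R\<close> at \<open>i_star\<close> is within distance \<open>\<gamma>\<close> of the identity,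
  and \<open>q\<^sup>2 \<ge> F (4 - F)\<close>; so \<open>F\<close> decreases at a definite rate while it lies strictly between the roots of
  \<open>F (4 - F) = 4 s\<^sup>2\<close>, where \<open>s = \<parallel>\<Omega>\<^sub>i\<parallel> / K\<close>. The larger root is the square of the prescribed radius
  \<open>\<Gamma>\<^sub>i\<close> and the smaller one is \<open>2 - 2 cos (arcsin s)\<close>.

  Chordal and geodesic distance are compared without diagonalizing \<open>R\<close>: the Cayley transform
  parametrizes the gradient flow of \<open>F\<close>, and the inequality for \<open>q\<close> shows that the flow line from
  the identity to \<open>R\<close> has length at most \<open>arccos (1 - F R / 2)\<close>.\<close>

subsection \<open>Matrix algebra and the trace defect\<close>

lemma bounded_bilinear_matrix_mult:
  "bounded_bilinear ((**) :: real^'n^'n \<Rightarrow> real^'n^'n \<Rightarrow> real^'n^'n)"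
proof -
  have "bilinear ((**) :: real^'n^'n \<Rightarrow> real^'n^'n \<Rightarrow> real^'n^'n)"
    unfolding bilinear_def
    by (intro conjI allI linearI)
      (simp_all add: matrix_matrix_mult_def vec_eq_iff sum.distrib sum_distrib_left algebra_simps)
  then show ?thesis
    using bilinear_conv_bounded_bilinear by blast
qed

lemmas matrix_mult_simps =
  bounded_bilinear.add_left[OF bounded_bilinear_matrix_mult]
  bounded_bilinear.add_right[OF bounded_bilinear_matrix_mult]
  bounded_bilinear.diff_left[OF bounded_bilinear_matrix_mult]
  bounded_bilinear.diff_right[OF bounded_bilinear_matrix_mult]
  bounded_bilinear.minus_left[OF bounded_bilinear_matrix_mult]
  bounded_bilinear.minus_right[OF bounded_bilinear_matrix_mult]
  bounded_bilinear.scaleR_left[OF bounded_bilinear_matrix_mult]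
  bounded_bilinear.scaleR_right[OF bounded_bilinear_matrix_mult]
  bounded_bilinear.zero_left[OF bounded_bilinear_matrix_mult]
  bounded_bilinear.zero_right[OF bounded_bilinear_matrix_mult]

lemma transpose_add: "transpose (A + B) = transpose A + transpose (B :: real^'n^'n)"
  and transpose_diff: "transpose (A - B) = transpose A - transpose (B :: real^'n^'n)"
  and transpose_minus: "transpose (- A) = - transpose (A :: real^'n^'n)"
  by (simp_all add: transpose_def vec_eq_iff)

lemma bounded_linear_trace: "bounded_linear (trace :: real^'n^'n \<Rightarrow> real)"
  by (intro linear_conv_bounded_linear[THEN iffD1] linearI)
    (simp_all add: trace_add, simp add: trace_def sum_distrib_left)

lemmas trace_simps =
  bounded_linear.linear[OF bounded_linear_trace, THEN linear_scale]
  bounded_linear.linear[OF bounded_linear_trace, THEN linear_neg]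
  bounded_linear.linear[OF bounded_linear_trace, THEN linear_0]
  trace_add trace_sub

lemmas transpose_simps = transpose_add transpose_diff transpose_minus transpose_scalar matrix_transpose_mul

lemma trace_transpose: "trace (transpose A) = trace A"
  by (simp add: trace_def transpose_def)

lemma inner_matrix_eq_trace: "A \<bullet> B = trace (transpose A ** (B :: real^'n^'n))"
  unfolding trace_def matrix_matrix_mult_def transpose_def inner_vec_def
  by simp (rule sum.swap)

lemma mat_norm_eq: "mat_norm A = norm A / sqrt 2"
  by (simp add: mat_norm_def mat_inner_def norm_eq_sqrt_inner inner_matrix_eq_trace real_sqrt_divide)

lemma SO_iff: "R \<in> SO \<longleftrightarrow> transpose R ** R = mat 1 \<and> det R = 1"
  by (simp add: SO_def rotation_matrix_def orthogonal_matrix)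

lemma SO_transpose_mult: "R \<in> SO \<Longrightarrow> transpose R ** R = mat 1"
  and SO_mult_transpose: "R \<in> SO \<Longrightarrow> R ** transpose R = mat 1"
  by (auto simp: SO_def rotation_matrix_def orthogonal_matrix_def)

lemma SO_mult: "P \<in> SO \<Longrightarrow> R \<in> SO \<Longrightarrow> P ** R \<in> SO"
  by (simp add: SO_def rotation_matrix_def orthogonal_matrix_mul det_mul)

lemma inner_matrix_vector_transpose: "(A *v x) \<bullet> y = x \<bullet> (transpose A *v (y :: real^'n))"
  by (metis dot_lmul_matrix inner_commute transpose_matrix_vector)

lemma inner_orthogonal_matrix:
  fixes Q :: "real^'n^'n"
  assumes "transpose Q ** Q = mat 1"
  shows "(Q *v x) \<bullet> (Q *v y) = x \<bullet> y"
  by (metis assms inner_matrix_vector_transpose matrix_vector_mul_assoc matrix_vector_mul_lid)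

text \<open>For a rotation with angles \<open>theta_j\<close> this is the sum of the
  \<open>2 - 2 cos theta_j\<close>; it is the \<open>F\<close> of the overview.\<close>

definition trace_defect :: "real^'n^'n \<Rightarrow> real" where
  "trace_defect R = trace (mat 1 - R)"

lemma norm_sq_one_minus:
  fixes R :: "real^'n^'n"
  assumes "transpose R ** R = mat 1"
  shows "(norm (mat 1 - R))\<^sup>2 = 2 * trace_defect R"
  unfolding power2_norm_eq_inner inner_matrix_eq_trace trace_defect_def
  by (simp only: transpose_simps matrix_mult_simps trace_simps assms trace_transpose
      matrix_mul_lid matrix_mul_rid transpose_mat) simp

text \<open>Lets the Cauchy-Schwarz bound on the skew drift be expressed through
  \<open>trace_defect (R ** R)\<close>.\<close>

lemma norm_sq_minus_transpose:
  fixes R :: "real^'n^'n"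
  assumes "R \<in> SO"
  shows "(norm (R - transpose R))\<^sup>2 = 2 * trace_defect (R ** R)"
proof -
  have "trace (transpose R ** transpose R) = trace (R ** R)"
    by (metis matrix_transpose_mul trace_transpose)
  then show ?thesis
    unfolding power2_norm_eq_inner inner_matrix_eq_trace trace_defect_def
    by (simp only: transpose_simps matrix_mult_simps trace_simps SO_transpose_mult SO_mult_transpose
        assms transpose_transpose) simp
qed

lemma trace_defect_nonneg: "transpose R ** R = mat 1 \<Longrightarrow> 0 \<le> trace_defect R"
  using norm_sq_one_minus[of R] zero_le_power2[of "norm (mat 1 - R)"] by linarith

lemma trace_eq_sum_inner: "trace (A :: real^'n^'n) = (\<Sum>i\<in>UNIV. axis i 1 \<bullet> (A *v axis i 1))"
  by (simp add: trace_def inner_axis' matrix_vector_mult_basis column_def)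

text \<open>A Householder reflection, obtained by conjugating a coordinate flip with an orthogonal
  matrix that carries an axis to \<open>v\<close>.\<close>

lemma reflection_exists:
  fixes v :: "real^'n"
  assumes "norm v = 1"
  obtains H :: "real^'n^'n" where "transpose H ** H = mat 1" "det H = - 1" "H *v v = - v"
    "\<And>x. x \<bullet> v = 0 \<Longrightarrow> H *v x = x"
proof -
  obtain k and A :: "real^'n^'n" where A: "orthogonal_matrix A" "A *v (axis k 1) = v"
    using orthogonal_matrix_exists_basis[OF assms] by metis
  define D :: "real^'n^'n" where "D = (\<chi> i j. if i = j then (if i = k then - 1 else 1) else 0)"
  have AA: "A ** transpose A = mat 1" "transpose A ** A = mat 1"
    using A by (auto simp: orthogonal_matrix_def)
  have detA: "det A * det A = 1"
    by (metis AA(1) det_I det_mul det_transpose)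
  have detD: "det D = - 1"
  proof -
    have "det D = (\<Prod>i\<in>UNIV. D $ i $ i)"
      by (rule det_diagonal) (simp add: D_def)
    also have "\<dots> = - 1"
      by (simp add: D_def prod.delta)
    finally show ?thesis .
  qed
  have Dx: "D *v x = (\<chi> i. if i = k then - x $ i else x $ i)" for x
    by (simp add: D_def matrix_vector_mult_def vec_eq_iff if_distrib[of "\<lambda>c. c * _"] cong: if_cong)
  have DD: "transpose D ** D = mat 1"
    by (simp add: D_def transpose_def matrix_matrix_mult_def mat_def vec_eq_iff
        if_distrib[of "\<lambda>c. c * _"] cong: if_cong)
  let ?H = "A ** (D ** transpose A)"
  show thesis
  proof
    have "transpose ?H ** ?H = A ** (transpose D ** ((transpose A ** A) ** (D ** transpose A)))"
      by (simp add: transpose_simps flip: matrix_mul_assoc)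
    also have "\<dots> = A ** ((transpose D ** D) ** transpose A)"
      unfolding AA by (simp add: matrix_mul_assoc)
    also have "\<dots> = mat 1"
      by (simp add: DD AA)
    finally show "transpose ?H ** ?H = mat 1" .
    show "det ?H = - 1"
      using detA by (simp add: det_mul detD)
    have *: "transpose A *v v = axis k 1"
      by (metis A(2) AA(2) matrix_vector_mul_assoc matrix_vector_mul_lid)
    have "D *v axis k 1 = - axis k 1"
      by (simp add: Dx axis_def vec_eq_iff)
    then have "?H *v v = A *v (- axis k 1)"
      using * by (simp flip: matrix_vector_mul_assoc)
    then show "?H *v v = - v"
      using A(2) by (metis scaleR_minus1_left matrix_vector_mult_scaleR)
    fix x assume "x \<bullet> v = 0"
    then have "(transpose A *v x) $ k = 0"
      by (metis A(2) inner_axis inner_commute inner_matrix_vector_transpose inner_real_def mult.right_neutral)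
    then have "D *v (transpose A *v x) = transpose A *v x"
      by (auto simp: Dx vec_eq_iff)
    then show "?H *v x = x"
      by (metis AA(1) matrix_vector_mul_assoc matrix_vector_mul_lid)
  qed
qed

lemma singular_imp_kernel:
  fixes A :: "real^'n^'n"
  assumes "det A = 0"
  obtains x where "x \<noteq> 0" "A *v x = 0"
  using assms by (metis invertible_det_nz invertible_left_inverse matrix_left_invertible_ker)

text \<open>Composing with the reflection in the hyperplane orthogonal to \<open>v\<close> turns \<open>R\<close> into an orthogonal
  matrix of determinant \<open>-1\<close> fixing \<open>v\<close>, and such a matrix has the eigenvalue \<open>-1\<close>.\<close>

lemma SO_minus_one_eigenvectors:
  fixes R :: "real^'n^'n"
  assumes R: "R \<in> SO" and v: "norm v = 1" and Rv: "R *v v = - v"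
  obtains w where "norm w = 1" "v \<bullet> w = 0" "R *v w = - w"
proof -
  obtain H :: "real^'n^'n" where H: "transpose H ** H = mat 1" "det H = - 1" "H *v v = - v"
    "\<And>x. x \<bullet> v = 0 \<Longrightarrow> H *v x = x"
    using reflection_exists[OF v] by metis
  let ?Q = "R ** H"
  have Q: "transpose ?Q ** ?Q = mat 1"
    using orthogonal_matrix_mul[of R H] R H(1) by (simp add: SO_iff orthogonal_matrix)
  have detQ: "det ?Q = - 1"
    using R H by (simp add: det_mul SO_iff)
  \<comment> \<open>Taking determinants gives
    \<open>det (mat 1 + ?Q) = - det (mat 1 + ?Q)\<close>.\<close>
  have "transpose ?Q ** (mat 1 + ?Q) = transpose (mat 1 + ?Q)"
    by (simp add: matrix_mult_simps Q transpose_add add.commute)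
  then have "det ?Q * det (mat 1 + ?Q) = det (mat 1 + ?Q)"
    by (metis det_mul det_transpose)
  then have "det (mat 1 + ?Q) = 0"
    using detQ by simp
  then obtain x where x: "x \<noteq> 0" "(mat 1 + ?Q) *v x = 0"
    by (rule singular_imp_kernel)
  then have Qx: "?Q *v x = - x"
    by (simp add: algebra_simps eq_neg_iff_add_eq_0)
  have Qv: "?Q *v v = v"
    using Rv matrix_vector_mult_scaleR[of R "- 1" v] by (simp add: H(3) flip: matrix_vector_mul_assoc)
  \<comment> \<open>\<open>?Q\<close> preserves inner products, negates \<open>x\<close> and fixes
    \<open>v\<close>. Hence the reflection fixes \<open>x\<close>, so \<open>R\<close> itself
    negates \<open>x\<close>.\<close>
  have "x \<bullet> v = 0"
    using inner_orthogonal_matrix[OF Q, of x v] Qx Qv by simp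
  then have Rx: "R *v x = - x"
    using Qx H(4) by (simp flip: matrix_vector_mul_assoc)
  show thesis
  proof
    show "norm (x /\<^sub>R norm x) = 1" using x by simp
    show "v \<bullet> (x /\<^sub>R norm x) = 0" using \<open>x \<bullet> v = 0\<close> by (simp add: inner_commute)
    show "R *v (x /\<^sub>R norm x) = - (x /\<^sub>R norm x)" using Rx by (simp add: matrix_vector_mult_scaleR)
  qed
qed

subsection \<open>The trace defect of a square\<close>

lemma norm_sq_matrix_columns:
  "(norm (A :: real^'n^'n))\<^sup>2 = (\<Sum>j\<in>UNIV. (norm (A *v axis j 1))\<^sup>2)"
  unfolding power2_norm_eq_inner inner_matrix_eq_trace trace_eq_sum_inner
  by (intro sum.cong refl) (metis inner_matrix_vector_transpose matrix_vector_mul_assoc)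

lemma norm_transpose: "norm (transpose A) = norm (A :: real^'n^'n)"
  by (simp add: norm_eq_sqrt_inner inner_matrix_eq_trace) (metis trace_mul_sym)

text \<open>Bessel's inequality for each row of \<open>A\<close>, summed over the rows.\<close>

lemma norm_sq_orthonormal_pair_le:
  fixes A :: "real^'n^'n"
  assumes "norm v = 1" "norm w = 1" "v \<bullet> w = 0"
  shows "(norm (A *v v))\<^sup>2 + (norm (A *v w))\<^sup>2 \<le> (norm A)\<^sup>2"
proof -
  have vw: "v \<bullet> v = 1" "w \<bullet> w = 1" "w \<bullet> v = 0"
    using assms by (auto simp: norm_eq_1 inner_commute)
  have Bessel: "(m \<bullet> v)\<^sup>2 + (m \<bullet> w)\<^sup>2 \<le> m \<bullet> m" for m :: "real^'n"
  proof -
    have "0 \<le> (m - (m \<bullet> v) *\<^sub>R v - (m \<bullet> w) *\<^sub>R w) \<bullet> (m - (m \<bullet> v) *\<^sub>R v - (m \<bullet> w) *\<^sub>R w)"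
      by simp
    also have "\<dots> = m \<bullet> m - (m \<bullet> v)\<^sup>2 - (m \<bullet> w)\<^sup>2"
      by (simp add: inner_diff_left inner_diff_right vw assms(3) power2_eq_square inner_commute[of v m]
          inner_commute[of w m])
    finally show ?thesis by simp
  qed
  have rows: "(norm (A *v x))\<^sup>2 = (\<Sum>i\<in>UNIV. (A $ i \<bullet> x)\<^sup>2)" for x
    unfolding power2_norm_eq_inner inner_vec_def[of "A *v x"]
    by (simp add: matrix_vector_mul_component power2_eq_square)
  have "(norm (A *v v))\<^sup>2 + (norm (A *v w))\<^sup>2 = (\<Sum>i\<in>UNIV. (A $ i \<bullet> v)\<^sup>2 + (A $ i \<bullet> w)\<^sup>2)"
    by (simp add: rows sum.distrib)
  also have "\<dots> \<le> (\<Sum>i\<in>UNIV. A $ i \<bullet> A $ i)"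
    by (intro sum_mono Bessel)
  also have "\<dots> = (norm A)\<^sup>2"
    by (simp add: power2_norm_eq_inner inner_vec_def[of A])
  finally show ?thesis .
qed

lemma norm_sq_matrix_mult_le:
  fixes A B :: "real^'n^'n"
  assumes "\<And>x. (norm (A *v x))\<^sup>2 \<le> c * (norm x)\<^sup>2"
  shows "(norm (A ** B))\<^sup>2 \<le> c * (norm B)\<^sup>2"
  unfolding norm_sq_matrix_columns[of "A ** B"] norm_sq_matrix_columns[of B] sum_distrib_left
  by (intro sum_mono) (metis assms matrix_vector_mul_assoc)

text \<open>The eigenvalues of \<open>transpose (mat 1 - R) ** (mat 1 - R)\<close> have even multiplicity unless they
  vanish, so the largest one is at most half of the trace. A second maximizer \<open>w\<close> of
  \<open>norm ((mat 1 - R) *v x)\<close> on the unit sphere is obtained from \<open>R *v v\<close>, or, when \<open>v\<close> is an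
  eigenvector of \<open>R\<close>, from the determinant condition.\<close>

lemma one_minus_SO_bound:
  fixes R :: "real^'n^'n"
  assumes R: "R \<in> SO"
  shows "(norm ((mat 1 - R) *v x))\<^sup>2 \<le> trace_defect R * (norm x)\<^sup>2"
proof -
  let ?M = "mat 1 - R"
  have "continuous_on (sphere 0 1) (\<lambda>x. norm (?M *v x))"
    by (intro continuous_intros linear_continuous_on matrix_vector_mul_bounded_linear)
  moreover have "sphere (0 :: real^'n) 1 \<noteq> {}"
    by simp
  ultimately obtain v :: "real^'n" where v: "norm v = 1"
    and max: "\<And>y. norm y = 1 \<Longrightarrow> norm (?M *v y) \<le> norm (?M *v v)"
    using continuous_attains_sup[of "sphere (0 :: real^'n) 1" "\<lambda>x. norm (?M *v x)"] compact_sphere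
    by (metis dist_0_norm mem_sphere)
  define \<mu> where "\<mu> = (norm (?M *v v))\<^sup>2"
  have le: "(norm (?M *v y))\<^sup>2 \<le> \<mu> * (norm y)\<^sup>2" for y
  proof (cases "y = 0")
    case False
    have "norm (?M *v (y /\<^sub>R norm y)) \<le> norm (?M *v v)"
      by (rule max) (use False in simp)
    then have "norm (?M *v y) \<le> norm (?M *v v) * norm y"
      using False by (simp add: matrix_vector_mult_scaleR field_simps)
    then have "(norm (?M *v y))\<^sup>2 \<le> (norm (?M *v v) * norm y)\<^sup>2"
      by (intro power_mono) auto
    then show ?thesis
      by (simp add: \<mu>_def power_mult_distrib)
  qed simp
  have normR: "norm (R *v y) = norm y" for y
    using inner_orthogonal_matrix[OF SO_transpose_mult[OF R], of y y] by (simp add: norm_eq_sqrt_inner)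
  have MM: "(norm ?M)\<^sup>2 = 2 * trace_defect R"
    by (rule norm_sq_one_minus) (rule SO_transpose_mult[OF R])
  have "\<mu> \<le> trace_defect R"
  proof (cases "\<exists>w. norm w = 1 \<and> v \<bullet> w = 0 \<and> \<mu> \<le> (norm (?M *v w))\<^sup>2")
    case True
    then obtain w where w: "norm w = 1" "v \<bullet> w = 0" "\<mu> \<le> (norm (?M *v w))\<^sup>2"
      by blast
    have "\<mu> + \<mu> \<le> (norm ?M)\<^sup>2"
      using norm_sq_orthonormal_pair_le[OF v w(1,2), of ?M] w(3) unfolding \<mu>_def by linarith
    then show ?thesis
      using MM by simp
  next
    case False
    define c where "c = v \<bullet> (R *v v)"
    define y where "y = R *v v - c *\<^sub>R v"
    have vy: "v \<bullet> y = 0"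
      using v by (simp add: y_def c_def inner_diff_right norm_eq_1)
    \<comment> \<open>Since \<open>?M\<close> commutes with \<open>R\<close>, the vector
      \<open>R *v v\<close> attains the ratio \<open>\<mu>\<close> just as \<open>v\<close> does.
      The parallelogram law, together with \<open>le\<close> for the sum \<open>?a' + ?b'\<close>,
      passes the bound on to the difference \<open>y\<close>.\<close>
    have "\<mu> * (norm y)\<^sup>2 \<le> (norm (?M *v y))\<^sup>2"
    proof -
      let ?a = "?M *v (R *v v)" and ?b = "c *\<^sub>R (?M *v v)"
      let ?a' = "R *v v" and ?b' = "c *\<^sub>R v"
      have par: "(norm (p - q))\<^sup>2 + (norm (p + q))\<^sup>2 = 2 * (norm p)\<^sup>2 + 2 * (norm q)\<^sup>2" for p q :: "real^'n"
        by (simp add: power2_norm_eq_inner inner_diff_left inner_diff_right inner_add_left inner_add_right)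
      have "?a = R *v (?M *v v)"
        by (simp add: algebra_simps)
      then have "(norm ?a)\<^sup>2 = \<mu> * (norm ?a')\<^sup>2" "(norm ?b)\<^sup>2 = \<mu> * (norm ?b')\<^sup>2"
        by (simp_all add: normR \<mu>_def v power_mult_distrib)
      moreover have "(norm (?a + ?b))\<^sup>2 \<le> \<mu> * (norm (?a' + ?b'))\<^sup>2"
        using le[of "?a' + ?b'"] by (simp add: matrix_vector_right_distrib matrix_vector_mult_scaleR)
      moreover have "?M *v y = ?a - ?b"
        by (simp add: y_def matrix_vector_mult_diff_distrib matrix_vector_mult_scaleR)
      moreover have "\<mu> * ((norm (?a' - ?b'))\<^sup>2 + (norm (?a' + ?b'))\<^sup>2) = \<mu> * (2 * (norm ?a')\<^sup>2 + 2 * (norm ?b')\<^sup>2)"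
        by (simp only: par)
      ultimately show ?thesis
        using par[of ?a ?b] by (simp add: y_def distrib_left)
    qed
    then have "\<mu> \<le> (norm (?M *v (y /\<^sub>R norm y)))\<^sup>2" if "y \<noteq> 0"
      using that by (simp add: matrix_vector_mult_scaleR power_mult_distrib field_simps)
    moreover have "norm (y /\<^sub>R norm y) = 1" "v \<bullet> (y /\<^sub>R norm y) = 0" if "y \<noteq> 0"
      using vy that by simp_all
    \<comment> \<open>Otherwise the normalized \<open>y\<close> would be the second maximizer that
      this case excludes.\<close>
    ultimately have "y = 0"
      using False by blast
    then have Rv: "R *v v = c *\<^sub>R v"
      by (simp add: y_def)
    then have "\<bar>c\<bar> = 1"
      using normR[of v] v by simp
    then consider "c = 1" | "c = - 1"
      by linarith
    then show ?thesis
    proof cases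
      case 1
      then have "\<mu> = 0"
        using Rv by (simp add: \<mu>_def algebra_simps)
      then show ?thesis
        using trace_defect_nonneg SO_transpose_mult[OF R] by simp
    next
      case 2
      then have Rv: "R *v v = - v"
        using Rv by simp
      obtain w where w: "norm w = 1" "v \<bullet> w = 0" "R *v w = - w"
        using SO_minus_one_eigenvectors[OF R v Rv] .
      have "norm (?M *v w) = norm (2 *\<^sub>R w)" "norm (?M *v v) = norm (2 *\<^sub>R v)"
        using Rv w(3) by (simp_all add: algebra_simps scaleR_2)
      then have False
        using False w v by (auto simp: \<mu>_def)
      then show ?thesis ..
    qed
  qed
  then show ?thesis
    using le[of x] by (meson mult_right_mono order_trans zero_le_power2)
qed

text \<open>With \<open>M = mat 1 - R\<close> and \<open>F = trace_defect R\<close>, the squared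
  norm of \<open>M ** transpose M\<close> is \<open>8 * F - 2 * trace_defect (R ** R)\<close>.
  Applying \<open>one_minus_SO_bound\<close> to the columns of \<open>transpose M\<close> bounds it
  by \<open>F * (2 * F)\<close>.\<close>

lemma trace_defect_square_ge:
  fixes R :: "real^'n^'n"
  assumes R: "R \<in> SO"
  shows "trace_defect R * (4 - trace_defect R) \<le> trace_defect (R ** R)"
proof -
  let ?M = "mat 1 - R"
  have tt: "trace (transpose R ** transpose R) = trace (R ** R)"
    by (metis matrix_transpose_mul trace_transpose)
  have MMT: "?M ** transpose ?M = 2 *\<^sub>R mat 1 - R - transpose R"
    by (simp add: transpose_simps matrix_mult_simps SO_mult_transpose[OF R] scaleR_2)
  have "(norm (?M ** transpose ?M))\<^sup>2 = trace ((2 *\<^sub>R mat 1 - R - transpose R) ** (2 *\<^sub>R mat 1 - R - transpose R))"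
    unfolding power2_norm_eq_inner inner_matrix_eq_trace MMT
    by (simp add: transpose_simps add.commute diff_diff_eq)
  also have "\<dots> = 8 * trace_defect R - 2 * trace_defect (R ** R)"
    unfolding trace_defect_def
    by (simp only: transpose_simps matrix_mult_simps trace_simps SO_transpose_mult[OF R] SO_mult_transpose[OF R]
        tt trace_transpose matrix_mul_lid matrix_mul_rid) (simp add: algebra_simps)
  finally have "8 * trace_defect R - 2 * trace_defect (R ** R) = (norm (?M ** transpose ?M))\<^sup>2"
    by simp
  also have "\<dots> \<le> trace_defect R * (norm (transpose ?M))\<^sup>2"
    by (rule norm_sq_matrix_mult_le) (rule one_minus_SO_bound[OF R])
  also have "\<dots> = trace_defect R * (2 * trace_defect R)"
    by (simp add: norm_transpose norm_sq_one_minus SO_transpose_mult[OF R])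
  finally show ?thesis
    by (simp add: algebra_simps)
qed

text \<open>\<open>mat 1 - R\<close> doubles any vector negated by \<open>R\<close>, which the
  operator bound permits only if the trace defect is at least 4.\<close>

lemma SO_one_plus_invertible:
  fixes R :: "real^'n^'n"
  assumes R: "R \<in> SO" and F: "trace_defect R < 4"
  shows "invertible (mat 1 + R)"
proof (rule ccontr)
  assume "\<not> invertible (mat 1 + R)"
  then obtain x where x: "x \<noteq> 0" "(mat 1 + R) *v x = 0"
    by (metis invertible_det_nz singular_imp_kernel)
  then have "R *v x = - x"
    by (simp add: algebra_simps eq_neg_iff_add_eq_0)
  then have "(mat 1 - R) *v x = 2 *\<^sub>R x"
    by (simp add: algebra_simps scaleR_2)
  then have "4 * (norm x)\<^sup>2 \<le> trace_defect R * (norm x)\<^sup>2"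
    using one_minus_SO_bound[OF R, of x] by (simp add: power_mult_distrib)
  then show False
    using x F by simp
qed

subsection \<open>The Cayley transform\<close>

lemma matrix_inv_right: "invertible A \<Longrightarrow> A ** matrix_inv A = mat 1"
  and matrix_inv_left: "invertible A \<Longrightarrow> matrix_inv A ** A = mat 1"
  unfolding invertible_def matrix_inv_def by (metis (mono_tags, lifting) someI_ex)+

lemma matrix_inv_eqI:
  fixes A B :: "real^'n^'n"
  assumes "A ** B = mat 1"
  shows "matrix_inv A = B"
proof -
  have "invertible A"
    using assms invertible_right_inverse by blast
  then have "matrix_inv A ** (A ** B) = B"
    by (simp add: matrix_inv_left matrix_mul_assoc)
  then show ?thesis
    by (simp add: assms)
qed

text \<open>When \<open>mat 1 + A\<close> is invertible this is
  \<open>(mat 1 - A) ** matrix_inv (mat 1 + A)\<close>. In the form chosen, only the inverse has to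
  be differentiated.\<close>

definition cayley :: "real^'n^'n \<Rightarrow> real^'n^'n" where
  "cayley A = 2 *\<^sub>R matrix_inv (mat 1 + A) - mat 1"

lemma one_plus_skew_invertible:
  assumes "A \<in> skew_matrices"
  shows "invertible (mat 1 + A)"
proof -
  have "x = 0" if "(mat 1 + A) *v x = 0" for x
  proof -
    have "(A *v x) \<bullet> x = - ((A *v x) \<bullet> x)"
      using assms inner_matrix_vector_transpose[of A x x] matrix_vector_mult_diff_rdistrib[of 0 A x]
      by (simp add: skew_matrices_def inner_commute del: transpose_matrix_vector)
    moreover have "x + A *v x = 0"
      using that by (simp add: algebra_simps)
    ultimately have "x \<bullet> x = 0"
      by (metis add.right_neutral equation_minus_iff inner_add_left inner_zero_left neg_equal_zero)
    then show ?thesis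
      by simp
  qed
  then show ?thesis
    by (metis invertible_det_nz singular_imp_kernel)
qed

context
  fixes A B :: "real^'n^'n"
  assumes A: "A \<in> skew_matrices" and B: "B = matrix_inv (mat 1 + A)"
begin

lemma one_plus_skew_inverse: "(mat 1 + A) ** B = mat 1" "B ** (mat 1 + A) = mat 1"
  using matrix_inv_right matrix_inv_left one_plus_skew_invertible[OF A] by (auto simp: B)

text \<open>Sandwiching \<open>mat 1 - A\<close> and \<open>mat 1 + A\<close> between
  \<open>B\<close> and \<open>transpose B\<close> gives \<open>B\<close> and
  \<open>transpose B\<close>; the two sandwiched matrices add up to twice the identity. This is the
  cancellation that makes \<open>cayley A\<close> orthogonal.\<close>

lemma inverse_plus_transpose: "B + transpose B = 2 *\<^sub>R (B ** transpose B)"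
proof -
  have "B ** (transpose (mat 1 + A) ** transpose B) = B"
    by (simp add: one_plus_skew_inverse(2) flip: matrix_transpose_mul)
  moreover have "B ** ((mat 1 + A) ** transpose B) = transpose B"
    by (simp add: matrix_mul_assoc one_plus_skew_inverse(2))
  moreover have "transpose (mat 1 + A) = mat 1 - A"
    using A by (simp add: skew_matrices_def transpose_add)
  ultimately have "B + transpose B = B ** ((mat 1 - A) ** transpose B) + B ** ((mat 1 + A) ** transpose B)"
    by simp
  then show ?thesis
    by (simp add: matrix_mult_simps scaleR_2)
qed

lemma cayley_SO: "cayley A \<in> SO"
proof -
  have "cayley A ** transpose (cayley A) = 4 *\<^sub>R (B ** transpose B) - 2 *\<^sub>R (B + transpose B) + mat 1"
    unfolding cayley_def B[symmetric]
    by (simp add: transpose_simps matrix_mult_simps algebra_simps)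
  also have "\<dots> = mat 1"
    by (simp add: inverse_plus_transpose)
  finally have "transpose (cayley A) ** cayley A = mat 1"
    using matrix_left_right_inverse by blast
  moreover have "det (cayley A) = 1"
  proof -
    have "cayley A = (2 *\<^sub>R mat 1 - (mat 1 + A)) ** B"
      unfolding cayley_def B[symmetric] by (simp add: one_plus_skew_inverse matrix_mult_simps(3,7))
    also have "2 *\<^sub>R mat 1 - (mat 1 + A) = transpose (mat 1 + A)"
      using A by (simp add: skew_matrices_def transpose_add scaleR_2)
    finally show ?thesis
      by (metis det_I det_mul det_transpose one_plus_skew_inverse(1))
  qed
  ultimately show ?thesis
    by (simp add: SO_iff)
qed

text \<open>Applied to \<open>u *\<^sub>R A\<close>, this makes \<open>mat 1 - g u ** g u\<close>
  equal to \<open>- 2 u\<close> times the derivative of \<open>g u = cayley (u *\<^sub>R A)\<close>,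
  so for positive \<open>u\<close> the curve runs along the gradient of the trace defect.\<close>

lemma one_minus_cayley_square: "mat 1 - cayley A ** cayley A = 4 *\<^sub>R (B ** A ** B)"
proof -
  have "B ** A ** B = B ** (mat 1 + A) ** B - B ** B"
    by (simp add: matrix_mult_simps)
  then have *: "B ** A ** B = B - B ** B"
    by (simp add: one_plus_skew_inverse)
  show ?thesis
    unfolding * cayley_def B[symmetric] matrix_mult_simps by (simp add: vec_eq_iff)
qed

end

text \<open>The Cayley transform is an involution, so \<open>A\<close> is given by the same formula
  applied to \<open>R\<close>. Skewness of \<open>A\<close> amounts to
  \<open>M + transpose M = mat 1\<close>, which follows by sandwiching
  \<open>(1 + R) (1 + R)^T = (1 + R) + (1 + R)^T\<close> between \<open>M\<close> and
  \<open>transpose M\<close>.\<close>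

lemma cayley_surj:
  fixes R :: "real^'n^'n"
  assumes R: "R \<in> SO" and inv: "invertible (mat 1 + R)"
  obtains A where "A \<in> skew_matrices" "R = cayley A"
proof -
  define M where "M = matrix_inv (mat 1 + R)"
  have M: "(mat 1 + R) ** M = mat 1" "M ** (mat 1 + R) = mat 1"
    using inv by (auto simp: M_def matrix_inv_left matrix_inv_right)
  define A where "A = 2 *\<^sub>R M - mat 1"
  have "(mat 1 + R) ** transpose (mat 1 + R) = (mat 1 + R) + transpose (mat 1 + R)"
    by (simp add: transpose_add matrix_mult_simps SO_mult_transpose[OF R])
  then have "M ** ((mat 1 + R) ** transpose (mat 1 + R)) ** transpose M
      = M ** ((mat 1 + R) + transpose (mat 1 + R)) ** transpose M"
    by simp
  moreover have "M ** ((mat 1 + R) ** transpose (mat 1 + R)) ** transpose M = mat 1"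
    by (simp add: matrix_mul_assoc M(2)) (metis M(2) matrix_transpose_mul transpose_mat)
  moreover have "M ** (transpose (mat 1 + R)) ** transpose M = M"
    by (metis M(2) matrix_mul_assoc matrix_mul_rid matrix_transpose_mul transpose_mat)
  ultimately have MMt: "mat 1 = transpose M + M"
    by (simp add: matrix_mult_simps(1) matrix_mult_simps(2)[of M "mat 1 + R"] M(2))
  have "A \<in> skew_matrices"
  proof -
    have "transpose M = mat 1 - M"
      by (simp add: MMt)
    then show ?thesis
      by (simp add: skew_matrices_def A_def transpose_simps scaleR_diff_right) (simp add: scaleR_2)
  qed
  moreover have "matrix_inv (mat 1 + A) = (1/2) *\<^sub>R (mat 1 + R)"
    by (rule matrix_inv_eqI) (simp add: A_def matrix_mult_simps(7,8) M)
  then have "R = cayley A"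
    by (simp add: cayley_def)
  ultimately show thesis
    by (rule that)
qed

lemma norm_SO: "R \<in> SO \<Longrightarrow> norm (R :: real^'n^'n) = sqrt (real CARD('n))"
  by (simp add: norm_eq_sqrt_inner inner_matrix_eq_trace SO_transpose_mult trace_I)

lemma scaleR_skew: "A \<in> skew_matrices \<Longrightarrow> u *\<^sub>R A \<in> skew_matrices"
  by (simp add: skew_matrices_def transpose_scalar)

text \<open>Everything rests on the resolvent identity \<open>diff\<close>. Since \<open>B u\<close>
  is the average of two rotations, its norm is bounded uniformly in \<open>u\<close>; the identity
  then gives a Lipschitz bound for \<open>B\<close>, hence continuity, and with it the
  derivative.\<close>

lemma cayley_has_vector_derivative:
  fixes A :: "real^'n^'n"
  assumes A: "A \<in> skew_matrices"
  defines "B \<equiv> \<lambda>u. matrix_inv (mat 1 + u *\<^sub>R A)"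
  shows "((\<lambda>u. cayley (u *\<^sub>R A)) has_vector_derivative - 2 *\<^sub>R (B u ** A ** B u)) (at u)"
    and "continuous_on UNIV B"
proof -
  have "\<exists>K>0. \<forall>(X :: real^'n^'n) (Y :: real^'n^'n). norm (X ** Y) \<le> norm X * norm Y * K"
    by (rule bounded_bilinear.pos_bounded[OF bounded_bilinear_matrix_mult])
  then obtain K where K: "K > 0" "\<And>(X :: real^'n^'n) (Y :: real^'n^'n). norm (X ** Y) \<le> norm X * norm Y * K"
    by auto
  define c where "c = sqrt (real CARD('n))"
  have c: "c > 0" by (simp add: c_def)
  have normB: "norm (B u) \<le> c" for u
  proof -
    have "B u = (1/2) *\<^sub>R (cayley (u *\<^sub>R A) + mat 1)"
      by (simp add: cayley_def B_def)
    then have "norm (B u) \<le> (1/2) * (norm (cayley (u *\<^sub>R A)) + norm (mat 1 :: real^'n^'n))"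
      by (simp only: norm_scaleR) (simp add: norm_triangle_ineq)
    also have "\<dots> = c"
      using norm_SO[OF cayley_SO[OF scaleR_skew[OF A] refl], of u]
        norm_SO[of "mat 1 :: real^'n^'n"] by (simp add: c_def SO_iff)
    finally show ?thesis .
  qed
  have diff: "B s - B u = - (s - u) *\<^sub>R (B s ** A ** B u)" for s u
  proof -
    have "B s ** ((mat 1 + u *\<^sub>R A) - (mat 1 + s *\<^sub>R A)) ** B u = B s - B u"
      using one_plus_skew_inverse[OF scaleR_skew[OF A] refl, of s] one_plus_skew_inverse[OF scaleR_skew[OF A] refl, of u]
      unfolding matrix_mult_simps(3,4) by (simp add: B_def flip: matrix_mul_assoc)
    then show ?thesis
      by (simp add: matrix_mult_simps algebra_simps)
  qed
  define L where "L = c * norm A * K * c * K"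
  have Lip: "norm (B s - B u) \<le> L * \<bar>s - u\<bar>" for s u
  proof -
    have "norm (B s ** A ** B u) \<le> norm (B s ** A) * norm (B u) * K"
      by (rule K)
    also have "\<dots> \<le> (norm (B s) * norm A * K) * norm (B u) * K"
      by (intro mult_right_mono K) (use K in auto)
    also have "\<dots> \<le> (c * norm A * K) * c * K"
      by (intro mult_mono normB) (use K c in auto)
    finally have "norm (B s ** A ** B u) * \<bar>s - u\<bar> \<le> L * \<bar>s - u\<bar>"
      unfolding L_def by (rule mult_right_mono) simp
    then show ?thesis
      unfolding diff[of s u] by (simp add: mult.commute abs_minus_commute)
  qed
  have L: "L \<ge> 0" using K c by (simp add: L_def)
  have contB: "isCont B u" for u
  proof -
    have "((\<lambda>s. L * \<bar>s - u\<bar>) \<longlongrightarrow> 0) (at u)"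
      by (rule tendsto_eq_intros refl | simp)+
    then have "((\<lambda>s. B s - B u) \<longlongrightarrow> 0) (at u)"
      by (rule Lim_null_comparison[rotated]) (simp add: Lip)
    then show ?thesis
      by (simp add: isCont_def LIM_zero_iff)
  qed
  then show "continuous_on UNIV B"
    by (simp add: continuous_at_imp_continuous_on)
  have "(B has_vector_derivative - (B u ** A ** B u)) (at u)"
    unfolding has_vector_derivative_def
  proof (rule has_derivativeI_sandwich[where e = 1])
    show "bounded_linear (\<lambda>h. h *\<^sub>R - (B u ** A ** B u))"
      by (rule bounded_linear_scaleR_left)
    fix s assume "s \<noteq> u"
    have "(B s - B u) ** (A ** B u) = B s ** A ** B u - B u ** A ** B u"
      by (simp add: matrix_mult_simps(3) matrix_mul_assoc)
    moreover have "B s - B u - (s - u) *\<^sub>R - (B u ** A ** B u)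
        = - (s - u) *\<^sub>R (B s ** A ** B u) - (s - u) *\<^sub>R - (B u ** A ** B u)"
      by (subst diff[of s u]) (rule refl)
    ultimately have "B s - B u - (s - u) *\<^sub>R - (B u ** A ** B u) = - (s - u) *\<^sub>R ((B s - B u) ** (A ** B u))"
      by (simp only: scaleR_diff_right scaleR_minus_left scaleR_minus_right)
    then have "norm (B s - B u - (s - u) *\<^sub>R - (B u ** A ** B u)) / norm (s - u) = norm ((B s - B u) ** (A ** B u))"
      using \<open>s \<noteq> u\<close> by (simp add: abs_minus_commute[of u s])
    then show "norm (B s - B u - (s - u) *\<^sub>R - (B u ** A ** B u)) / norm (s - u)
        \<le> norm ((B s - B u) ** (A ** B u))"
      by simp
  next
    have "((\<lambda>s. (B s - B u) ** (A ** B u)) \<longlongrightarrow> (B u - B u) ** (A ** B u)) (at u)"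
      by (intro bounded_bilinear.tendsto[OF bounded_bilinear_matrix_mult] tendsto_intros contB[unfolded isCont_def])
    then show "((\<lambda>s. norm ((B s - B u) ** (A ** B u))) \<longlongrightarrow> 0) (at u)"
      by (simp add: tendsto_norm_zero)
  qed simp
  from has_vector_derivative_diff[OF bounded_linear.has_vector_derivative[OF bounded_linear_scaleR_right[of 2] this] has_vector_derivative_const[of "mat 1"]]
  show "((\<lambda>u. cayley (u *\<^sub>R A)) has_vector_derivative - 2 *\<^sub>R (B u ** A ** B u)) (at u)"
    by (simp add: cayley_def B_def)
qed

subsection \<open>Lengths of curves in the rotation group\<close>

definition SO_lengths :: "real^'n^'n \<Rightarrow> real^'n^'n \<Rightarrow> real set" where
  "SO_lengths P Q = {L. \<exists>g. valid_path g \<and> path_image g \<subseteq> SO \<and>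
     pathstart g = P \<and> pathfinish g = Q \<and>
     ((\<lambda>t. mat_norm (vector_derivative g (at t))) has_integral L) {0..1}}"

lemma SO_dist_eq_Inf: "SO_dist P Q = Inf (SO_lengths P Q)"
  by (simp add: SO_dist_def SO_lengths_def)

text \<open>The velocity integrates to \<open>Q - P\<close>, and the norm of an integral is at most
  the integral of the norm. The fundamental theorem is used in the form that tolerates the finitely
  many exceptional parameters.\<close>

lemma chord_le_length:
  assumes "L \<in> SO_lengths P Q"
  shows "mat_norm (Q - P) \<le> L"
proof -
  obtain g where g: "valid_path g" "pathstart g = P" "pathfinish g = Q"
    and L: "((\<lambda>t. mat_norm (vector_derivative g (at t))) has_integral L) {0..1}"
    using assms by (auto simp: SO_lengths_def)
  obtain S where S: "finite S" "g C1_differentiable_on ({0..1} - S)"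
    using g(1) by (auto simp: valid_path_def piecewise_C1_differentiable_on_def)
  have int: "((\<lambda>t. vector_derivative g (at t)) has_integral (g 1 - g 0)) {0..1}"
  proof (rule fundamental_theorem_of_calculus_interior_strong[OF S(1)])
    show "continuous_on {0..1} g"
      using g(1) by (auto simp: valid_path_def piecewise_C1_differentiable_on_def)
    fix t assume "t \<in> {0<..<1} - S"
    then show "(g has_vector_derivative vector_derivative g (at t)) (at t)"
      using S(2) by (auto simp: C1_differentiable_on_eq vector_derivative_works)
  qed simp
  have "norm (g 1 - g 0) \<le> sqrt 2 * L"
    unfolding integral_unique[OF int, symmetric]
      integral_unique[OF has_integral_mult_right[OF L, of "sqrt 2"], symmetric]
    by (rule integral_norm_bound_integral)
      (use int has_integral_mult_right[OF L, of "sqrt 2"] in \<open>auto simp: mat_norm_eq\<close>)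
  then show ?thesis
    using g by (simp add: mat_norm_eq pathstart_def pathfinish_def field_simps)
qed

lemma C1_path_length:
  assumes der: "\<And>u. (g has_vector_derivative g' u) (at u)" and cont: "continuous_on UNIV g'"
    and SO: "\<And>u. g u \<in> SO"
  shows "integral {0..1} (\<lambda>u. mat_norm (g' u)) \<in> SO_lengths (g 0) (g 1)"
proof -
  have "g C1_differentiable_on {0..1}"
    unfolding C1_differentiable_on_def using der cont continuous_on_subset by blast
  then have "valid_path g"
    unfolding valid_path_def by (rule C1_differentiable_imp_piecewise)
  moreover have "continuous_on {0..1} (\<lambda>u. mat_norm (g' u))"
    unfolding mat_norm_eq by (intro continuous_intros continuous_on_subset[OF cont]) auto
  then have "((\<lambda>u. mat_norm (g' u)) has_integral integral {0..1} (\<lambda>u. mat_norm (g' u))) {0..1}"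
    by (simp add: integrable_continuous_real integrable_integral)
  ultimately show ?thesis
    using SO vector_derivative_at[OF der]
    by (auto simp: SO_lengths_def pathstart_def pathfinish_def path_image_def intro!: exI[of _ g])
qed

text \<open>The curves live on the whole real line, so no one-sided derivatives arise at 0 and
  1.\<close>

definition SO_reachable :: "(real^'n^'n) set" where
  "SO_reachable = {g 1 | g g'. (\<forall>u. (g has_vector_derivative g' u) (at u)) \<and> continuous_on UNIV g' \<and>
     (\<forall>u. g u \<in> SO) \<and> g 0 = mat 1}"

lemma SO_reachableI:
  assumes "\<And>u. (g has_vector_derivative g' u) (at u)" "continuous_on UNIV g'" "\<And>u. g u \<in> SO" "g 0 = mat 1"
  shows "g 1 \<in> SO_reachable"
  unfolding SO_reachable_def using assms by blast

text \<open>The pointwise product of the two curves works; unlike a concatenation it stays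
  continuously differentiable.\<close>

lemma SO_reachable_mult:
  assumes "P \<in> SO_reachable" "Q \<in> SO_reachable"
  shows "P ** Q \<in> SO_reachable"
proof -
  obtain g g' where g: "P = g 1" "g 0 = mat 1" "\<And>u. (g has_vector_derivative g' u) (at u)"
    "continuous_on UNIV g'" "\<And>u. g u \<in> SO"
    using assms(1) by (auto simp: SO_reachable_def)
  obtain h h' where h: "Q = h 1" "h 0 = mat 1" "\<And>u. (h has_vector_derivative h' u) (at u)"
    "continuous_on UNIV h'" "\<And>u. h u \<in> SO"
    using assms(2) by (auto simp: SO_reachable_def)
  have "continuous_on UNIV g" "continuous_on UNIV h"
    using g(3) h(3) by (auto intro!: continuous_at_imp_continuous_on has_vector_derivative_continuous)
  then have "continuous_on UNIV (\<lambda>u. g u ** h' u + g' u ** h u)"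
    by (intro continuous_on_add bounded_bilinear.continuous_on[OF bounded_bilinear_matrix_mult] g h)
  moreover have "((\<lambda>u. g u ** h u) has_vector_derivative g u ** h' u + g' u ** h u) (at u)" for u
    by (rule bounded_bilinear.has_vector_derivative[OF bounded_bilinear_matrix_mult g(3) h(3)])
  ultimately have "g 1 ** h 1 \<in> SO_reachable"
    using SO_reachableI[of "\<lambda>u. g u ** h u" "\<lambda>u. g u ** h' u + g' u ** h u"] by (simp add: g h SO_mult)
  then show ?thesis
    by (simp add: g h)
qed

lemma cayley_zero: "cayley (0 :: real^'n^'n) = mat 1"
  using matrix_inv_eqI[of "mat 1" "mat 1 :: real^'n^'n"] by (simp add: cayley_def scaleR_2)

lemma continuous_on_cayley_derivative:
  fixes A :: "real^'n^'n"
  assumes "A \<in> skew_matrices"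
  shows "continuous_on UNIV (\<lambda>u. - 2 *\<^sub>R (matrix_inv (mat 1 + u *\<^sub>R A) ** A ** matrix_inv (mat 1 + u *\<^sub>R A)))"
  by (intro continuous_intros bounded_bilinear.continuous_on[OF bounded_bilinear_matrix_mult]
      cayley_has_vector_derivative(2)[OF assms])

lemma cayley_reachable:
  fixes A :: "real^'n^'n"
  assumes "A \<in> skew_matrices"
  shows "cayley A \<in> SO_reachable"
  using SO_reachableI[OF cayley_has_vector_derivative(1)[OF assms] continuous_on_cayley_derivative[OF assms]
      cayley_SO[OF scaleR_skew[OF assms] refl]]
  by (simp add: cayley_zero)

section \<open>Half turns and connectedness of the rotation group\<close>

definition outer :: "real^'n \<Rightarrow> real^'n \<Rightarrow> real^'n^'n" where
  "outer v w = (\<chi> i j. v $ i * w $ j)"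

lemma outer_mult_outer: "outer a b ** outer c d = (b \<bullet> c) *\<^sub>R outer a d"
  by (simp add: outer_def matrix_matrix_mult_def vec_eq_iff inner_vec_def sum_distrib_left sum_distrib_right mult_ac)

lemma matrix_mult_outer: "A ** outer v w = outer (A *v v) w"
  by (simp add: outer_def matrix_matrix_mult_def matrix_vector_mult_def vec_eq_iff sum_distrib_left sum_distrib_right mult_ac)

lemma trace_outer: "trace (outer v w) = v \<bullet> w"
  by (simp add: trace_def outer_def inner_vec_def)

lemma transpose_outer: "transpose (outer v w) = outer w v"
  by (simp add: transpose_def outer_def vec_eq_iff mult.commute)

text \<open>\<open>cayley A\<close> is a quarter turn in the plane of \<open>v\<close> and
  \<open>w\<close>. A half turn has the eigenvalue \<open>-1\<close> and is no Cayley transform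
  itself, hence the square.\<close>

lemma plane_half_turn_cayley:
  fixes v w :: "real^'n"
  assumes "norm v = 1" "norm w = 1" "v \<bullet> w = 0"
  defines "A \<equiv> outer w v - outer v w"
  shows "A \<in> skew_matrices" "cayley A ** cayley A = mat 1 - 2 *\<^sub>R (outer v v + outer w w)"
proof -
  have vw: "v \<bullet> v = 1" "w \<bullet> w = 1" "v \<bullet> w = 0" "w \<bullet> v = 0"
    using assms by (auto simp: norm_eq_1 inner_commute)
  show "A \<in> skew_matrices"
    by (simp add: skew_matrices_def A_def transpose_diff transpose_outer)
  let ?X = "mat 1 - (1/2) *\<^sub>R (outer v v + outer w w + outer w v - outer v w)"
  have "(mat 1 + A) ** ?X = mat 1"
    unfolding A_def matrix_mult_simps outer_mult_outer vw by (simp add: vec_eq_iff field_simps)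
  then have "matrix_inv (mat 1 + A) = ?X"
    by (rule matrix_inv_eqI)
  then have C: "cayley A = mat 1 - (outer v v + outer w w + outer w v - outer v w)"
    unfolding cayley_def by (simp add: scaleR_diff_right scaleR_2[of "mat 1"])
  show "cayley A ** cayley A = mat 1 - 2 *\<^sub>R (outer v v + outer w w)"
    unfolding C matrix_mult_simps outer_mult_outer vw by (simp add: vec_eq_iff)
qed

text \<open>While \<open>-1\<close> is an eigenvalue of \<open>R\<close>, a half turn in a plane of eigenvectors raises the trace by
  \<open>4\<close>; once it is not, \<open>R\<close> is a Cayley transform.\<close>

lemma SO_subset_reachable: "(R :: real^'n^'n) \<in> SO \<Longrightarrow> R \<in> SO_reachable"
proof -
  \<comment> \<open>Induction on the trace defect in units of 4; for \<open>k = 0\<close> the claim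
    is vacuous because the defect is nonnegative.\<close>
  have "\<forall>R :: real^'n^'n. R \<in> SO \<longrightarrow> trace_defect R < 4 * real k \<longrightarrow> R \<in> SO_reachable" for k
  proof (induction k)
    case 0
    then show ?case
      using trace_defect_nonneg SO_transpose_mult by force
  next
    case (Suc k)
    show ?case
    proof (intro allI impI)
      fix R :: "real^'n^'n" assume R: "R \<in> SO" and F: "trace_defect R < 4 * real (Suc k)"
      show "R \<in> SO_reachable"
      proof (cases "invertible (mat 1 + R)")
        case True
        then show ?thesis
          by (metis R cayley_reachable cayley_surj)
      next
        case False
        then obtain x where x: "x \<noteq> 0" "(mat 1 + R) *v x = 0"
          by (metis invertible_det_nz singular_imp_kernel)
        define v where "v = x /\<^sub>R norm x"
        have "R *v x = - x"
          using x(2) by (simp add: algebra_simps eq_neg_iff_add_eq_0)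
        then have v: "norm v = 1" "R *v v = - v"
          using x(1) by (simp_all add: v_def matrix_vector_mult_scaleR)
        then obtain w where w: "norm w = 1" "v \<bullet> w = 0" "R *v w = - w"
          using SO_minus_one_eigenvectors[OF R] by metis
        define A where "A = outer w v - outer v w"
        define H where "H = mat 1 - 2 *\<^sub>R (outer v v + outer w w)"
        have A: "A \<in> skew_matrices" "cayley A ** cayley A = H"
          using plane_half_turn_cayley[OF v(1) w(1,2)] by (simp_all add: A_def H_def)
        have vw: "v \<bullet> v = 1" "w \<bullet> w = 1" "v \<bullet> w = 0" "w \<bullet> v = 0"
          using v w by (auto simp: norm_eq_1 inner_commute)
        have HH: "H ** H = mat 1"
          unfolding H_def matrix_mult_simps outer_mult_outer vw by (simp add: vec_eq_iff)
        have H: "H \<in> SO" "H \<in> SO_reachable"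
          using A SO_mult[of "cayley A" "cayley A"] SO_reachable_mult[of "cayley A" "cayley A"]
            cayley_reachable[OF A(1)] cayley_SO[OF A(1) refl] by auto
        have "outer (- v) v = - outer v v" "outer (- w) w = - outer w w"
          by (simp_all add: outer_def vec_eq_iff)
        then have "R ** H = R + 2 *\<^sub>R (outer v v + outer w w)"
          unfolding H_def matrix_mult_simps matrix_mult_outer v w by (simp add: vec_eq_iff)
        then have "trace_defect (R ** H) = trace_defect R - 4"
          by (simp only: trace_defect_def trace_simps trace_outer vw) simp
        then have "R ** H \<in> SO_reachable"
          using Suc.IH SO_mult[OF R H(1)] F by simp
        then have "(R ** H) ** H \<in> SO_reachable"
          using H(2) by (rule SO_reachable_mult)
        then show ?thesis
          by (simp add: HH flip: matrix_mul_assoc)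
      qed
    qed
  qed
  moreover obtain k :: nat where "trace_defect R / 4 < real k"
    using reals_Archimedean2 by blast
  ultimately show "R \<in> SO_reachable" if "R \<in> SO"
    using that by (simp add: field_simps)
qed

text \<open>Guarantees that \<open>SO_dist\<close> is a genuine infimum, so that lower bounds on
  lengths pass to it.\<close>

lemma SO_lengths_nonempty:
  assumes "R \<in> SO"
  shows "SO_lengths (mat 1) R \<noteq> {}"
proof -
  obtain g g' where g: "R = g 1" "g 0 = mat 1" "\<And>u. (g has_vector_derivative g' u) (at u)"
    "continuous_on UNIV g'" "\<And>u. g u \<in> SO"
    using SO_subset_reachable[OF assms] by (auto simp: SO_reachable_def)
  show ?thesis
    using C1_path_length[OF g(3,4,5)] g(1,2) by auto
qed

section \<open>Chordal against geodesic distance\<close>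

lemma mat_norm_nonneg: "0 \<le> mat_norm A"
  by (simp add: mat_norm_eq)

lemma SO_dist_le: "L \<in> SO_lengths P Q \<Longrightarrow> SO_dist P Q \<le> L"
  unfolding SO_dist_eq_Inf
  by (rule cInf_lower) (auto intro!: bdd_belowI[of _ 0] order_trans[OF mat_norm_nonneg chord_le_length])

lemma chord_le_SO_dist:
  assumes "R \<in> SO"
  shows "sqrt (trace_defect R) \<le> SO_dist (mat 1) R"
proof -
  have "sqrt (trace_defect R) = mat_norm (R - mat 1)"
  proof -
    have "norm (R - mat 1) = sqrt (2 * trace_defect R)"
      using norm_sq_one_minus[OF SO_transpose_mult[OF assms]]
      by (metis norm_ge_zero norm_minus_commute real_sqrt_unique)
    then show ?thesis
      by (simp add: mat_norm_eq real_sqrt_mult)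
  qed
  moreover have "mat_norm (R - mat 1) \<le> SO_dist (mat 1) R"
    unfolding SO_dist_eq_Inf by (rule cInf_greatest[OF SO_lengths_nonempty[OF assms]]) (rule chord_le_length)
  ultimately show ?thesis
    by simp
qed

lemma SO_dist_nonneg: "R \<in> SO \<Longrightarrow> 0 \<le> SO_dist (mat 1) R"
  using chord_le_SO_dist[of R] trace_defect_nonneg[OF SO_transpose_mult, of R]
  by (meson order_trans real_sqrt_ge_zero)

text \<open>Along \<open>g u = cayley (u *\<^sub>R A)\<close>, the gradient flow of the trace defect \<open>F\<close> up to
  reparametrization, the speed is \<open>F' / sqrt (trace_defect (g ** g)) \<le> F' / sqrt (F * (4 - F))\<close>,
  and the right-hand side is the derivative of \<open>arccos (1 - F / 2)\<close>.\<close>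

lemma SO_dist_le_arccos:
  fixes R :: "real^'n^'n"
  assumes R: "R \<in> SO" and F4: "trace_defect R < 4"
  shows "SO_dist (mat 1) R \<le> arccos (1 - trace_defect R / 2)"
proof -
  obtain A where A: "A \<in> skew_matrices" "R = cayley A"
    using cayley_surj[OF R SO_one_plus_invertible[OF R F4]] .
  define g where "g = (\<lambda>u. cayley (u *\<^sub>R A))"
  define B where "B = (\<lambda>u. matrix_inv (mat 1 + u *\<^sub>R A))"
  define g' where "g' = (\<lambda>u. - 2 *\<^sub>R (B u ** A ** B u))"
  define F where "F = (\<lambda>u. trace_defect (g u))"
  define v where "v = (\<lambda>u. mat_norm (g' u))"
  define q where "q = (\<lambda>u. sqrt (trace_defect (g u ** g u)))"
  have gSO: "g u \<in> SO" for u
    unfolding g_def by (rule cayley_SO[OF scaleR_skew[OF A(1)] refl])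
  have g01: "g 0 = mat 1" "g 1 = R"
    by (simp_all add: g_def cayley_zero A)
  have der_g: "(g has_vector_derivative g' u) (at u)" for u
    unfolding g_def g'_def B_def by (rule cayley_has_vector_derivative(1)[OF A(1)])
  have cont_g': "continuous_on UNIV g'"
    unfolding g'_def B_def by (rule continuous_on_cayley_derivative[OF A(1)])
  have len: "SO_dist (mat 1) R \<le> integral {0..1} v"
    using SO_dist_le[OF C1_path_length[OF der_g cont_g' gSO]] by (simp add: g01 v_def)
  have cont_v: "continuous_on {0..1} v"
    unfolding v_def mat_norm_eq by (intro continuous_intros continuous_on_subset[OF cont_g']) auto
  have square: "mat 1 - g u ** g u = - (2 * u) *\<^sub>R g' u" for u
    using one_minus_cayley_square[OF scaleR_skew[OF A(1)] refl, of u]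
    by (simp add: g_def g'_def B_def matrix_mult_simps)
  have q_sq: "(q u)\<^sup>2 = trace_defect (g u ** g u)" for u
    using trace_defect_nonneg[OF SO_transpose_mult[OF SO_mult[OF gSO gSO]], of u u] by (simp add: q_def)
  have q_nonneg: "0 \<le> q u" for u
    using trace_defect_nonneg[OF SO_transpose_mult[OF SO_mult[OF gSO gSO]], of u u] by (simp add: q_def)
  have speed: "v u = q u / (2 * u)" if "u > 0" for u
  proof -
    have "norm (mat 1 - g u ** g u) = sqrt (2 * (q u)\<^sup>2)"
      using norm_sq_one_minus[OF SO_transpose_mult[OF SO_mult[OF gSO gSO]], of u u] q_sq
      by (metis norm_ge_zero real_sqrt_unique)
    then have "2 * u * norm (g' u) = sqrt 2 * q u"
      using that q_nonneg by (simp add: square real_sqrt_mult abs_mult)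
    then show ?thesis
      using that by (simp add: v_def mat_norm_eq field_simps)
  qed
  \<comment> \<open>The trace of \<open>square\<close> reads
    \<open>(q u)\<^sup>2 = - 2 u trace (g' u)\<close>, and \<open>speed\<close> replaces one factor
    \<open>q u / (2 * u)\<close> by \<open>v u\<close>.\<close>
  have der_F: "(F has_real_derivative q u * v u) (at u)" if "u > 0" for u
  proof -
    have "((\<lambda>u. trace (mat 1) - trace (g u)) has_vector_derivative 0 - trace (g' u)) (at u)"
      by (intro has_vector_derivative_diff has_vector_derivative_const
          bounded_linear.has_vector_derivative[OF bounded_linear_trace] der_g)
    moreover have "- trace (g' u) = q u * v u"
    proof -
      have "(q u)\<^sup>2 = trace (- (2 * u) *\<^sub>R g' u)"
        by (simp only: q_sq trace_defect_def square)
      also have "\<dots> = - (2 * u) * trace (g' u)"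
        by (simp only: trace_simps real_scaleR_def)
      finally show ?thesis
        using that by (simp add: speed field_simps power2_eq_square)
    qed
    ultimately show ?thesis
      by (simp add: F_def trace_defect_def trace_sub has_real_derivative_iff_has_vector_derivative)
  qed
  have F_less: "F u < 4" if "0 < u" "u \<le> 1" for u
  proof -
    have "F u \<le> F 1"
    proof (rule DERIV_nonneg_imp_nondecreasing[OF that(2)])
      fix x assume "u \<le> x" "x \<le> 1"
      then show "\<exists>y. (F has_real_derivative y) (at x) \<and> 0 \<le> y"
        using that by (intro exI[of _ "q x * v x"] conjI der_F mult_nonneg_nonneg q_nonneg)
          (auto simp: v_def mat_norm_nonneg)
    qed
    then show ?thesis
      using F4 by (simp add: F_def g01)
  qed
  have F_zero: "A = 0" if "F u = 0" "u > 0" for u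
  proof -
    have "g u = mat 1"
      using norm_sq_one_minus[OF SO_transpose_mult[OF gSO], of u] that by (simp add: F_def)
    then have "2 *\<^sub>R B u = 2 *\<^sub>R mat 1"
      by (simp add: g_def cayley_def B_def scaleR_2 diff_eq_eq)
    then have "B u = mat 1"
      by simp
    then have "mat 1 + u *\<^sub>R A = mat 1"
      using one_plus_skew_inverse(1)[OF scaleR_skew[OF A(1)] refl, of u] by (simp add: B_def)
    then show ?thesis
      using that by simp
  qed
  \<comment> \<open>\<open>arccos\<close> is not differentiable at 1, that is, where
    \<open>F\<close> vanishes. For \<open>A = 0\<close> the curve is constant; otherwise
    \<open>F\<close> vanishes on the unit interval only at the endpoint 0, where continuity
    suffices.\<close>
  have "integral {0..1} v \<le> arccos (1 - F 1 / 2)"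
  proof (cases "A = 0")
    case True
    then have "v = (\<lambda>_. 0)"
      by (simp add: v_def g'_def mat_norm_eq)
    then show ?thesis
      using F4 trace_defect_nonneg[OF SO_transpose_mult[OF R]]
      by (simp add: F_def g01 arccos_lbound)
  next
    case False
    have F_pos: "F u > 0" if "u > 0" for u
      using F_zero[OF _ that] False trace_defect_nonneg[OF SO_transpose_mult[OF gSO], of u]
      by (force simp: F_def less_le)
    have F0: "F 0 = 0"
      by (simp add: F_def g01 trace_defect_def trace_simps)
    \<comment> \<open>\<open>H\<close> starts at 0 and has derivative
      \<open>q v / (2 r) - v\<close>, which is nonnegative because
      \<open>trace_defect_square_ge\<close> gives \<open>r \<le> q / 2\<close>.\<close>
    define H where "H = (\<lambda>u. arccos (1 - F u / 2) - integral {0..u} v)"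
    have "H 0 \<le> H 1"
    proof (rule DERIV_nonneg_imp_increasing_open[where f = H])
      fix u :: real assume u: "0 < u" "u < 1"
      let ?r = "sqrt (1 - (1 - F u / 2)\<^sup>2)"
      have F: "0 < F u" "F u < 4"
        using F_pos F_less u by auto
      have r: "?r = sqrt (F u * (4 - F u)) / 2"
      proof -
        have "1 - (1 - F u / 2)\<^sup>2 = F u * (4 - F u) / 4"
          by (simp add: power2_eq_square field_simps)
        then show ?thesis
          by (simp only: real_sqrt_divide) simp
      qed
      have rpos: "0 < ?r"
        using F unfolding r by simp
      have rle: "?r \<le> q u / 2"
        unfolding r q_def using trace_defect_square_ge[OF gSO, of u] by (simp add: F_def)
      have "((\<lambda>u. arccos (1 - F u / 2)) has_real_derivative inverse (- ?r) * (0 - q u * v u / 2)) (at u)"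
        by (intro DERIV_chain2[OF DERIV_arccos] DERIV_diff DERIV_const DERIV_cdivide der_F) (use F u in auto)
      moreover have "((\<lambda>u. integral {0..u} v) has_real_derivative v u) (at u)"
      proof -
        have "at u within {0..1} = at u"
          by (rule at_within_interior) (use u in simp)
        then show ?thesis
          using integral_has_real_derivative[OF cont_v, of u] u by auto
      qed
      ultimately have "(H has_real_derivative inverse (- ?r) * (0 - q u * v u / 2) - v u) (at u)"
        unfolding H_def by (rule DERIV_diff)
      moreover have "0 \<le> inverse (- ?r) * (0 - q u * v u / 2) - v u"
      proof -
        have "v u * ?r \<le> v u * (q u / 2)"
          using rle by (intro mult_left_mono) (auto simp: v_def mat_norm_nonneg)
        then have "v u \<le> (q u * v u / 2) / ?r"
          using rpos by (simp add: pos_le_divide_eq mult_ac)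
        moreover have "inverse (- a) * (0 - c) = c / a" for a c :: real
          by (simp add: divide_inverse)
        ultimately show ?thesis
          by (simp only: diff_ge_0_iff_ge)
      qed
      ultimately show "\<exists>y. (H has_real_derivative y) (at u) \<and> 0 \<le> y"
        by blast
    next
      have "continuous_on UNIV g"
        using der_g by (auto intro!: continuous_at_imp_continuous_on has_vector_derivative_continuous)
      then have "continuous_on {0..1} (\<lambda>u. trace (mat 1) - trace (g u))"
        by (intro continuous_intros bounded_linear.continuous_on[OF bounded_linear_trace])
          (auto intro: continuous_on_subset)
      then have "continuous_on {0..1} F"
        by (simp add: F_def trace_defect_def trace_sub)
      moreover have "0 \<le> F u" "F u \<le> 4" if "u \<in> {0..1}" for u
        using F_less[of u] F0 that trace_defect_nonneg[OF SO_transpose_mult[OF gSO], of u]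
        by (cases "u = 0"; force simp: F_def)+
      ultimately have "continuous_on {0..1} (\<lambda>u. arccos (1 - F u / 2))"
        by (intro continuous_on_arccos continuous_intros) (auto simp: field_simps)
      moreover have "continuous_on {0..1} (\<lambda>u. integral {0..u} v)"
        by (rule indefinite_integral_continuous_1) (rule integrable_continuous_real[OF cont_v])
      ultimately show "continuous_on {0..1} H"
        unfolding H_def by (rule continuous_on_diff)
    qed simp
    then show ?thesis
      by (simp add: H_def F0)
  qed
  then show ?thesis
    using len by (simp add: F_def g01)
qed

subsection \<open>Barriers and decay\<close>

text \<open>First-contact argument for the whole family at once. At the first time
  \<open>\<tau>\<close> at which some barrier is touched, all functions are still at or below
  theirs, so \<open>barrier\<close> applies; the negative derivative would put \<open>F k\<close>
  above its barrier just before \<open>\<tau>\<close>.\<close>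

lemma barrier_invariance:
  fixes F :: "'i \<Rightarrow> real \<Rightarrow> real" and b :: "'i \<Rightarrow> real"
  assumes fin: "finite J"
    and cont: "\<And>j. j \<in> J \<Longrightarrow> continuous_on {0..} (F j)"
    and init: "\<And>j. j \<in> J \<Longrightarrow> F j 0 < b j"
    and barrier: "\<And>t j. \<lbrakk>0 < t; \<And>l. l \<in> J \<Longrightarrow> F l t \<le> b l; j \<in> J; F j t = b j\<rbrakk>
      \<Longrightarrow> \<exists>D<0. (F j has_real_derivative D) (at t)"
    and "j \<in> J" "0 \<le> t"
  shows "F j t < b j"
proof (rule ccontr)
  assume contra: "\<not> F j t < b j"
  define S where "S = (\<Union>j\<in>J. {0..} \<inter> F j -` {b j..})"
  have "closed S"
    unfolding S_def by (intro closed_UN fin ballI continuous_closed_preimage cont) auto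
  moreover have "t \<in> S"
    using contra \<open>j \<in> J\<close> \<open>0 \<le> t\<close> by (force simp: S_def)
  moreover have bdd: "bdd_below S"
    by (auto simp: S_def intro!: bdd_belowI[of _ 0])
  ultimately have "Inf S \<in> S"
    using closed_contains_Inf[of S] by blast
  define \<tau> where "\<tau> = Inf S"
  obtain k where k: "k \<in> J" "b k \<le> F k \<tau>" "0 \<le> \<tau>"
    using \<open>Inf S \<in> S\<close> by (auto simp: S_def \<tau>_def)
  have before: "F l s < b l" if "l \<in> J" "0 \<le> s" "s < \<tau>" for l s
    using cInf_lower[OF _ bdd, of s] that by (force simp: S_def \<tau>_def)
  have "\<tau> > 0"
    using init[OF k(1)] k by (cases "\<tau> = 0") auto
  have le: "F l \<tau> \<le> b l" if "l \<in> J" for l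
  proof (rule tendsto_upperbound)
    have "isCont (F l) \<tau>"
      using cont[OF that] \<open>\<tau> > 0\<close> continuous_on_interior[of "{0..}" "F l" \<tau>] by (simp add: interior_Ici)
    then show "(F l \<longlongrightarrow> F l \<tau>) (at_left \<tau>)"
      unfolding isCont_def by (rule tendsto_mono[OF at_le, rotated]) simp
    show "\<forall>\<^sub>F s in at_left \<tau>. F l s \<le> b l"
      using eventually_at_left_field[of "\<lambda>s. F l s \<le> b l" \<tau>] \<open>\<tau> > 0\<close> before[OF that]
      by (meson less_imp_le)
  qed simp
  obtain D where D: "D < 0" "(F k has_real_derivative D) (at \<tau>)"
    using barrier[OF \<open>\<tau> > 0\<close> le k(1)] k le[OF k(1)] by fastforce
  obtain d where d: "d > 0" "\<And>h. 0 < h \<Longrightarrow> h < d \<Longrightarrow> F k \<tau> < F k (\<tau> - h)"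
    using DERIV_neg_dec_left[OF D(2,1)] by blast
  define h where "h = min (d / 2) \<tau>"
  have "F k \<tau> < F k (\<tau> - h)"
    using d \<open>\<tau> > 0\<close> by (intro d(2)) (auto simp: h_def)
  moreover have "F k (\<tau> - h) < b k"
    using d \<open>\<tau> > 0\<close> by (intro before k) (auto simp: h_def)
  ultimately show False
    using k by simp
qed

lemma eventually_below_of_decay:
  fixes F :: "real \<Rightarrow> real"
  assumes cont: "continuous_on {0..} F" and nonneg: "\<And>t. 0 \<le> t \<Longrightarrow> 0 \<le> F t" and "\<delta> > 0"
    and decay: "\<And>t. 0 < t \<Longrightarrow> x < F t \<Longrightarrow> \<exists>D\<le>-\<delta>. (F has_real_derivative D) (at t)"
  shows "eventually (\<lambda>t. F t \<le> x) at_top"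
proof -
  have stay: "F t \<le> x" if s: "0 \<le> s" "s \<le> t" "F s \<le> x" for s t
  proof (rule ccontr)
    assume Ft: "\<not> F t \<le> x"
    \<comment> \<open>\<open>Sup S\<close> is the last time up to \<open>t\<close> with
      \<open>F \<le> x\<close>; after it \<open>F\<close> exceeds \<open>x\<close> and decreases, so
      it could not have risen.\<close>
    define S where "S = {s..t} \<inter> F -` {..x}"
    have "closed S"
      unfolding S_def by (intro continuous_closed_preimage continuous_on_subset[OF cont]) (use s in auto)
    moreover have "s \<in> S" and bdd: "bdd_above S"
      using s by (auto simp: S_def intro!: bdd_aboveI[of _ t])
    ultimately have "Sup S \<in> S"
      using closed_contains_Sup[of S] by blast
    then have \<sigma>: "s \<le> Sup S" "Sup S \<le> t" "F (Sup S) \<le> x"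
      by (auto simp: S_def)
    have "F t \<le> F (Sup S)"
    proof (rule DERIV_nonpos_imp_decreasing_open[OF \<sigma>(2)])
      fix r assume r: "Sup S < r" "r < t"
      then have "x < F r"
        using cSup_upper[OF _ bdd, of r] \<sigma> by (force simp: S_def)
      then show "\<exists>y. (F has_real_derivative y) (at r) \<and> y \<le> 0"
        using decay[of r] r \<sigma> s \<open>\<delta> > 0\<close> by fastforce
    next
      show "continuous_on {Sup S..t} F"
        using s \<sigma> by (intro continuous_on_subset[OF cont]) auto
    qed
    then show False
      using \<sigma> Ft by simp
  qed
  have "\<exists>s\<ge>0. F s \<le> x"
  proof (rule ccontr)
    assume "\<not> ?thesis"
    then have gt: "x < F s" if "0 \<le> s" for s
      using that by force
    \<comment> \<open>Decay at rate \<open>\<delta>\<close> up to this time would force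
      \<open>F T \<le> - \<delta>\<close>.\<close>
    define T where "T = F 0 / \<delta> + 1"
    have "T \<ge> 0"
      using nonneg[of 0] \<open>\<delta> > 0\<close> by (simp add: T_def)
    have "F T + \<delta> * T \<le> F 0 + \<delta> * 0"
    proof (rule DERIV_nonpos_imp_decreasing_open[OF \<open>T \<ge> 0\<close>])
      fix r assume r: "0 < r" "r < T"
      then obtain D where D: "D \<le> - \<delta>" "(F has_real_derivative D) (at r)"
        using decay gt by (meson less_imp_le)
      have "((\<lambda>t. F t + \<delta> * t) has_real_derivative D + \<delta> * 1) (at r)"
        by (intro DERIV_add D DERIV_cmult DERIV_ident)
      then show "\<exists>y. ((\<lambda>t. F t + \<delta> * t) has_real_derivative y) (at r) \<and> y \<le> 0"
        using D by fastforce
    next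
      show "continuous_on {0..T} (\<lambda>t. F t + \<delta> * t)"
        by (intro continuous_intros continuous_on_subset[OF cont]) auto
    qed
    moreover have "\<delta> * T = F 0 + \<delta>"
      using \<open>\<delta> > 0\<close> by (simp add: T_def field_simps)
    ultimately show False
      using nonneg[OF \<open>T \<ge> 0\<close>] \<open>\<delta> > 0\<close> by simp
  qed
  then show ?thesis
    unfolding eventually_at_top_linorder using stay by blast
qed

text \<open>If \<open>n div 2\<close> were 0, the domain would be a single point, too small for a
  support reaching \<open>\<beta> > 0\<close>.\<close>

lemma influence_profile_domain:
  assumes "influence_profile n \<beta> f" "0 < \<beta>"
  shows "pi \<le> real (n div 2) * pi"
proof -
  have cl: "closure {r \<in> {0..real (n div 2) * pi}. f r \<noteq> 0} = {0..\<beta>}"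
    using assms by (simp add: influence_profile_def Let_def)
  have "n div 2 \<noteq> 0"
  proof
    assume "n div 2 = 0"
    then have "{r \<in> {0..real (n div 2) * pi}. f r \<noteq> 0} \<subseteq> {0}"
      by auto
    then have "closure {r \<in> {0..real (n div 2) * pi}. f r \<noteq> 0} \<subseteq> {0}"
      by (rule closure_minimal) simp
    then have "{0..\<beta>} \<subseteq> {0}"
      by (simp only: cl)
    moreover have "\<beta> \<in> {0..\<beta>}"
      using assms(2) by simp
    ultimately show False
      using assms(2) by blast
  qed
  then have "1 \<le> real (n div 2)"
    by (simp del: of_nat_div)
  then show ?thesis
    using pi_gt_zero by (simp del: of_nat_div)
qed

text \<open>A zero at \<open>\<gamma>\<close> would, by monotonicity and nonnegativity, confine the
  support to \<open>{..\<gamma>}\<close>.\<close>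

lemma influence_profile_pos:
  assumes prof: "influence_profile n \<beta> f" and \<gamma>: "0 \<le> \<gamma>" "\<gamma> < \<beta>" "\<gamma> \<le> pi"
  shows "0 < f \<gamma>"
proof -
  let ?D = "{0..real (n div 2) * pi}"
  have cl: "closure {r \<in> ?D. f r \<noteq> 0} = {0..\<beta>}" and nonneg: "\<And>r. r \<in> ?D \<Longrightarrow> 0 \<le> f r"
    and anti: "antimono_on ?D f"
    using prof by (simp_all add: influence_profile_def Let_def del: of_nat_div)
  have \<gamma>D: "\<gamma> \<in> ?D"
    using order_trans[OF \<gamma>(3) influence_profile_domain[OF prof order_le_less_trans[OF \<gamma>(1,2)]]] \<gamma>
    by simp
  have "f \<gamma> \<noteq> 0"
  proof
    assume "f \<gamma> = 0"
    then have "f r = 0" if "r \<in> ?D" "\<gamma> \<le> r" for r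
      using monotone_onD[OF anti \<gamma>D that] nonneg[OF that(1)] by simp
    then have "{r \<in> ?D. f r \<noteq> 0} \<subseteq> {..\<gamma>}"
      by (force simp del: of_nat_div)
    then have "closure {r \<in> ?D. f r \<noteq> 0} \<subseteq> {..\<gamma>}"
      by (rule closure_minimal) simp
    then have "{0..\<beta>} \<subseteq> {..\<gamma>}"
      by (simp only: cl)
    then show False
      using \<gamma> by auto
  qed
  then show ?thesis
    using nonneg[OF \<gamma>D] by simp
qed

text \<open>A skew matrix only sees the skew part of \<open>R\<close>: the left-hand side is half of
  \<open>W \<bullet> (R - transpose R)\<close>, to which Cauchy-Schwarz applies.\<close>

lemma skew_drift_le:
  fixes R W :: "real^'n^'n"
  assumes W: "W \<in> skew_matrices" and R: "R \<in> SO"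
  shows "- trace (W ** R) \<le> mat_norm W * sqrt (trace_defect (R ** R))"
proof -
  have Wt: "transpose W = - W"
    using W by (simp add: skew_matrices_def)
  have "trace (W ** transpose R) = trace (transpose (R ** transpose W))"
    by (simp add: transpose_simps)
  also have "\<dots> = - trace (W ** R)"
    by (simp add: trace_transpose Wt matrix_mult_simps trace_simps trace_mul_sym[of R W])
  finally have "W \<bullet> (R - transpose R) = - 2 * trace (W ** R)"
    by (simp add: inner_matrix_eq_trace Wt matrix_mult_simps trace_simps)
  moreover have "norm (R - transpose R) = sqrt (2 * trace_defect (R ** R))"
    using norm_sq_minus_transpose[OF R] by (metis norm_ge_zero real_sqrt_unique)
  ultimately have "- 2 * trace (W ** R) \<le> norm W * (sqrt 2 * sqrt (trace_defect (R ** R)))"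
    using norm_cauchy_schwarz[of W "R - transpose R"] by (simp add: real_sqrt_mult)
  moreover have "mat_norm W = norm W * sqrt 2 / 2"
    by (simp add: mat_norm_eq field_simps)
  then have "2 * (mat_norm W * sqrt (trace_defect (R ** R))) = norm W * (sqrt 2 * sqrt (trace_defect (R ** R)))"
    by simp
  ultimately show ?thesis
    by linarith
qed

lemma trace_defect_has_derivative:
  fixes R :: "real \<Rightarrow> real^'n^'n"
  assumes "(R has_vector_derivative W ** R t + c *\<^sub>R (mat 1 - R t ** R t)) (at t)"
  shows "((\<lambda>t. trace_defect (R t)) has_real_derivative
    - trace (W ** R t) - c * trace_defect (R t ** R t)) (at t)"
proof -
  have "((\<lambda>t. trace (mat 1) - trace (R t)) has_vector_derivative
      0 - trace (W ** R t + c *\<^sub>R (mat 1 - R t ** R t))) (at t)"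
    by (intro has_vector_derivative_diff has_vector_derivative_const
        bounded_linear.has_vector_derivative[OF bounded_linear_trace] assms)
  then show ?thesis
    by (simp add: has_real_derivative_iff_has_vector_derivative trace_defect_def trace_sub trace_add trace_simps)
qed

subsection \<open>Estimates along the flow\<close>

text \<open>For \<open>K > 0\<close> the parabola in \<open>q\<close> opens downwards and
  \<open>r\<close> lies at or beyond both of its roots, where it decreases.\<close>

lemma quadratic_drift_le:
  fixes K \<omega> r q :: real
  assumes "0 \<le> r" "r \<le> q" "\<omega> \<le> K / 2 * r" "0 \<le> K"
  shows "q * (\<omega> - K / 2 * q) \<le> r * (\<omega> - K / 2 * r)"
proof -
  have "q * (\<omega> - K / 2 * q) \<le> q * (\<omega> - K / 2 * r)"
    using assms by (intro mult_left_mono diff_left_mono mult_left_mono) auto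
  also have "\<dots> \<le> r * (\<omega> - K / 2 * r)"
    using assms by (intro mult_right_mono_neg) auto
  finally show ?thesis .
qed

text \<open>Replacing \<open>trace_defect (R t ** R t)\<close> by a lower bound \<open>m\<close>
  yields a rate that can be kept independent of time.\<close>

lemma trace_defect_drift_le:
  fixes R :: "real \<Rightarrow> real^'n^'n"
  assumes W: "W \<in> skew_matrices" and R: "R t \<in> SO" and "0 \<le> K" "K / 2 \<le> c"
    and m: "0 \<le> m" "mat_norm W \<le> K / 2 * sqrt m" "m \<le> trace_defect (R t) * (4 - trace_defect (R t))"
    and der: "(R has_vector_derivative W ** R t + c *\<^sub>R (mat 1 - R t ** R t)) (at t)"
  shows "\<exists>D \<le> sqrt m * (mat_norm W - K / 2 * sqrt m).
    ((\<lambda>t. trace_defect (R t)) has_real_derivative D) (at t)"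
proof -
  define q where "q = sqrt (trace_defect (R t ** R t))"
  have q2: "q\<^sup>2 = trace_defect (R t ** R t)"
    using trace_defect_nonneg[OF SO_transpose_mult[OF SO_mult[OF R R]]] by (simp add: q_def)
  have "sqrt m \<le> q"
    unfolding q_def using trace_defect_square_ge[OF R] m(3) by simp
  have "- trace (W ** R t) - c * trace_defect (R t ** R t) \<le> mat_norm W * q - K / 2 * q\<^sup>2"
    unfolding q2[symmetric] using skew_drift_le[OF W R] assms(4)
    by (intro diff_mono mult_right_mono) (auto simp: q_def)
  also have "\<dots> = q * (mat_norm W - K / 2 * q)"
    by (simp add: algebra_simps power2_eq_square)
  also have "\<dots> \<le> sqrt m * (mat_norm W - K / 2 * sqrt m)"
    by (rule quadratic_drift_le) (use m \<open>sqrt m \<le> q\<close> assms(3) in auto)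
  finally show ?thesis
    using trace_defect_has_derivative[OF der] by blast
qed

section \<open>From the trace defect to angles and balls\<close>

lemma SO_dist_le_angle:
  fixes R :: "real^'n^'n"
  assumes "R \<in> SO" "0 \<le> \<theta>" "\<theta> < pi" "trace_defect R \<le> 2 - 2 * cos \<theta>"
  shows "SO_dist (mat 1) R \<le> \<theta>"
proof -
  have "cos pi < cos \<theta>"
    using assms by (intro cos_monotone_0_pi) auto
  then have "trace_defect R < 4"
    using assms(4) by simp
  then have "SO_dist (mat 1) R \<le> arccos (1 - trace_defect R / 2)"
    by (rule SO_dist_le_arccos[OF assms(1)])
  also have "\<dots> \<le> arccos (cos \<theta>)"
    using assms(4) trace_defect_nonneg[OF SO_transpose_mult[OF assms(1)]]
    by (intro arccos_le_arccos) auto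
  also have "\<dots> = \<theta>"
    using assms by (simp add: arccos_cos)
  finally show ?thesis .
qed

lemma SO_dist_le_pi:
  fixes R :: "real^'n^'n"
  assumes "R \<in> SO" "trace_defect R < 4"
  shows "SO_dist (mat 1) R \<le> pi"
  using SO_dist_le_arccos[OF assms] arccos_ubound[of "1 - trace_defect R / 2"] assms(2)
    trace_defect_nonneg[OF SO_transpose_mult[OF assms(1)]]
  by simp

lemma trace_defect_less_square:
  assumes "R \<in> SO_ball r"
  shows "trace_defect R < r\<^sup>2"
proof -
  have R: "R \<in> SO" "SO_dist (mat 1) R < r"
    using assms by (auto simp: SO_ball_def)
  have "sqrt (trace_defect R) < r"
    using chord_le_SO_dist[OF R(1)] R(2) by linarith
  then show ?thesis
    using trace_defect_nonneg[OF SO_transpose_mult[OF R(1)]]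
    by (metis real_sqrt_ge_zero real_sqrt_pow2 power_strict_mono zero_less_numeral)
qed

lemma double_angle_chord: "(2 - 2 * cos \<theta>) * (4 - (2 - 2 * cos \<theta>)) = 4 * (sin \<theta> :: real)\<^sup>2"
  by (simp only: sin_squared_eq) (simp add: algebra_simps power2_eq_square)

text \<open>A concave function on an interval is at least the smaller of its endpoint values; the
  cases split at the vertex 2.\<close>

lemma chord_parabola_min_le:
  fixes x y b :: real
  assumes "x \<le> y" "y \<le> b"
  shows "min (x * (4 - x)) (b * (4 - b)) \<le> y * (4 - y)"
proof (cases "y \<le> 2")
  case True
  have "0 \<le> (y - x) * (4 - x - y)"
    using True assms by (intro mult_nonneg_nonneg) auto
  then show ?thesis by (simp add: algebra_simps)
next
  case False
  have "0 \<le> (b - y) * (b + y - 4)"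
    using False assms by (intro mult_nonneg_nonneg) auto
  then show ?thesis by (simp add: algebra_simps)
qed

theorem proposition3p2:
  fixes N :: nat and \<kappa> \<beta> \<gamma>0 \<gamma> :: real and I :: "real \<Rightarrow> real"
    and \<Omega> R0 :: "nat \<Rightarrow> real^'n^'n" and R :: "nat \<Rightarrow> real \<Rightarrow> real^'n^'n"
    and i_star :: nat
  assumes "0 < \<beta>" and "\<beta> < pi / 2"
    and "influence_profile CARD('n) \<beta> I"
    and "\<And>i. i \<in> {1..N} \<Longrightarrow> \<Omega> i \<in> skew_matrices"
    and "\<And>i. i \<in> {1..N} \<Longrightarrow> R0 i \<in> SO"
    and "0 < \<kappa>"
    and "0 < \<gamma>0" and "\<gamma>0 < 2 * sin (\<beta> / 2)"
    and "\<gamma> = 2 * arcsin (\<gamma>0 / 2)" and "\<gamma> < \<beta>"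
    and "i_star \<in> {1..N}" and "R0 i_star \<in> SO_ball \<gamma>0"
    and "\<kappa> > kappa_c N I \<Omega> \<gamma>"
    and "\<And>i. i \<in> {1..N} \<Longrightarrow> R0 i \<in> SO_ball (Gam N \<kappa> I (\<Omega> i) \<gamma>)"
    and "winfree_solution N \<kappa> I \<Omega> R0 R"
  shows "\<forall>i\<in>{1..N}.
    Limsup at_top (\<lambda>t. ereal (SO_dist (mat 1) (R i t)))
      \<le> ereal (2 * arcsin (1 / 2 * arcsin (real N * mat_norm (\<Omega> i) / (\<kappa> * I \<gamma>))))"
proof -
  note prof = assms(3) and skew = assms(4)
  have N: "0 < real N"
    using assms(11) by simp
  have \<gamma>0_half: "0 < \<gamma>0 / 2" "\<gamma>0 / 2 < 1"
    using assms(7,8) sin_le_one[of "\<beta> / 2"] by linarith+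
  have sin_half: "sin (\<gamma> / 2) = \<gamma>0 / 2"
    using \<gamma>0_half by (simp add: assms(9))
  have "0 < arcsin (\<gamma>0 / 2)"
    using \<gamma>0_half arcsin_less_arcsin[of 0 "\<gamma>0 / 2"] by simp
  then have \<gamma>: "0 < \<gamma>" "\<gamma> < \<beta>" "\<gamma> < pi / 2" "\<gamma> < pi"
    using assms(2,9,10) pi_gt_zero by auto
  have \<gamma>0_sq: "\<gamma>0\<^sup>2 = 2 - 2 * cos \<gamma>"
    using cos_double_sin[of "\<gamma> / 2"] by (simp add: sin_half power_divide)
  \<comment> \<open>The chord is shorter than its arc. The threshold \<open>kappa_c\<close> controls
    \<open>s\<close> by \<open>sin \<gamma>0\<close>, since
    \<open>2 * sin (\<gamma> / 2) = \<gamma>0\<close>; the barrier for \<open>i_star\<close> needs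
    \<open>sin \<gamma>\<close>.\<close>
  have "\<gamma>0 \<le> \<gamma>"
    using sin_x_le_x[of "\<gamma> / 2"] \<gamma> by (simp add: sin_half)
  then have sin_\<gamma>0: "0 < sin \<gamma>0" "sin \<gamma>0 \<le> sin \<gamma>"
    using \<gamma> assms(7) by (auto intro!: sin_gt_zero sin_monotone_2pi_le)
  have I_pos: "0 < I \<gamma>"
    using influence_profile_pos[OF prof] \<gamma> by simp
  define s where "s = (\<lambda>i. real N * mat_norm (\<Omega> i) / (\<kappa> * I \<gamma>))"
  \<comment> \<open>The coupling strength that \<open>i_star\<close> alone guarantees while it stays
    within distance \<open>\<gamma>\<close>.\<close>
  define K where "K = \<kappa> * I \<gamma> / real N"
  have K: "0 < K"
    using I_pos assms(6) N by (simp add: K_def)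
  have s_K: "mat_norm (\<Omega> i) = K * s i" for i
    using I_pos assms(6) N by (simp add: K_def s_def)
  have s_nonneg: "0 \<le> s i" for i
    using I_pos assms(6) N mat_norm_nonneg[of "\<Omega> i"] by (simp add: s_def)
  have s_less: "s i < sin \<gamma>" "s i < 1" if "i \<in> {1..N}" for i
  proof -
    have "mat_norm (\<Omega> i) \<le> Max ((\<lambda>j. mat_norm (\<Omega> j)) ` {1..N})"
      using that by (intro Max_ge) auto
    then have "real N * mat_norm (\<Omega> i) / (sin \<gamma>0 * I \<gamma>) \<le> kappa_c N I \<Omega> \<gamma>"
      unfolding kappa_c_def sin_half using sin_\<gamma>0 I_pos
      by (simp add: divide_right_mono mult_left_mono)
    then have "real N * mat_norm (\<Omega> i) / (sin \<gamma>0 * I \<gamma>) < \<kappa>"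
      using assms(13) by linarith
    then have "s i < sin \<gamma>0"
      using sin_\<gamma>0 I_pos assms(6) by (simp add: s_def field_simps)
    then show "s i < sin \<gamma>" "s i < 1"
      using sin_\<gamma>0 sin_le_one[of \<gamma>] by linarith+
  qed
  define F where "F = (\<lambda>i t. trace_defect (R i t))"
  have R_SO: "R i t \<in> SO" if "i \<in> {1..N}" "0 \<le> t" for i t
    using assms(15) that by (simp add: winfree_solution_def)
  have F_nonneg: "0 \<le> F i t" if "i \<in> {1..N}" "0 \<le> t" for i t
    using trace_defect_nonneg[OF SO_transpose_mult[OF R_SO[OF that]]] by (simp add: F_def)
  have cont: "continuous_on {0..} (F i)" if "i \<in> {1..N}" for i
    unfolding F_def trace_defect_def using assms(15) that
    by (intro bounded_linear.continuous_on[OF bounded_linear_trace] continuous_intros)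
      (simp add: winfree_solution_def)
  \<comment> \<open>Barrier heights strictly between the roots \<open>2 - 2 g\<close> and
    \<open>2 + 2 g\<close> of \<open>b * (4 - b) = 4 * (s i)\<^sup>2\<close>, where
    \<open>g = sqrt (1 - (s i)\<^sup>2)\<close>. For \<open>i_star\<close> the height is
    \<open>\<gamma>0\<^sup>2\<close>, which keeps it within distance
    \<open>\<gamma>\<close>.\<close>
  have "\<exists>b. F i 0 < b \<and> b < 4 \<and> 4 * (s i)\<^sup>2 < b * (4 - b) \<and> (i = i_star \<longrightarrow> b \<le> \<gamma>0\<^sup>2)"
    if i: "i \<in> {1..N}" for i
  proof (cases "i = i_star")
    case True
    have "F i 0 < \<gamma>0\<^sup>2"
      using trace_defect_less_square[OF assms(12)] assms(15) i True by (simp add: F_def winfree_solution_def)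
    moreover have "\<gamma>0\<^sup>2 < 4"
      using \<gamma>0_half power_strict_mono[of \<gamma>0 2 2] by simp
    moreover have "4 * (s i)\<^sup>2 < \<gamma>0\<^sup>2 * (4 - \<gamma>0\<^sup>2)"
      unfolding \<gamma>0_sq double_angle_chord using s_less[OF i] s_nonneg by (simp add: power_strict_mono)
    ultimately show ?thesis
      by blast
  next
    case False
    define g where "g = sqrt (1 - (s i)\<^sup>2)"
    have s1: "(s i)\<^sup>2 < 1"
      using s_less[OF i] s_nonneg power_strict_mono[of "s i" 1 2] by simp
    then have g: "0 < g" "g \<le> 1" "g\<^sup>2 = 1 - (s i)\<^sup>2"
      by (auto simp: g_def)
    have "Gam N \<kappa> I (\<Omega> i) \<gamma> = sqrt (2 + 2 * g)"
      by (simp add: Gam_def g_def s_def power_mult_distrib power_divide)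
    then have F0: "F i 0 < 2 + 2 * g"
      using trace_defect_less_square[OF assms(14)[OF i]] assms(15) i g(1)
      by (simp add: F_def winfree_solution_def)
    \<comment> \<open>The midpoint lies above both the initial value and 2, and below the larger
      root; being above 2 keeps it clear of the smaller root.\<close>
    define b where "b = (max (F i 0) 2 + (2 + 2 * g)) / 2"
    have b: "F i 0 < b" "2 < b" "b < 2 + 2 * g"
      using F0 g(1) by (auto simp: b_def)
    have "(b - 2)\<^sup>2 < (2 * g)\<^sup>2"
      using b by (intro power_strict_mono) auto
    then have "4 * (s i)\<^sup>2 < b * (4 - b)"
      using g(3) by (simp add: power_mult_distrib) (simp add: power2_eq_square algebra_simps)
    then show ?thesis
      using b g False by (intro exI[of _ b]) auto
  qed
  then obtain b where b: "\<And>i. i \<in> {1..N} \<Longrightarrow> F i 0 < b i" "\<And>i. i \<in> {1..N} \<Longrightarrow> b i < 4"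
    "\<And>i. i \<in> {1..N} \<Longrightarrow> 4 * (s i)\<^sup>2 < b i * (4 - b i)" "b i_star \<le> \<gamma>0\<^sup>2"
    using assms(11) by metis
  \<comment> \<open>Only the term of \<open>i_star\<close> is kept in the sum. The other terms are
    nonnegative because the barriers below 4 keep all distances at most \<open>pi\<close>, inside
    the domain of the profile.\<close>
  have coupling: "K / 2 \<le> \<kappa> / 2 * (1 / real N * (\<Sum>j=1..N. influence I (R j t)))"
    if t: "0 \<le> t" and le: "\<And>l. l \<in> {1..N} \<Longrightarrow> F l t \<le> b l" for t
  proof -
    let ?D = "{0..real (CARD('n) div 2) * pi}"
    have nonneg: "\<And>r. r \<in> ?D \<Longrightarrow> 0 \<le> I r" and anti: "antimono_on ?D I"
      using prof by (simp_all add: influence_profile_def Let_def del: of_nat_div)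
    have memD: "r \<in> ?D" if "0 \<le> r" "r \<le> pi" for r
      using that(1) order_trans[OF that(2) influence_profile_domain[OF prof assms(1)]] by simp
    have dom: "SO_dist (mat 1) (R l t) \<in> ?D" if l: "l \<in> {1..N}" for l
      using le[OF l] b(2)[OF l]
      by (intro memD SO_dist_nonneg SO_dist_le_pi R_SO[OF l t]) (simp add: F_def)
    have "SO_dist (mat 1) (R i_star t) \<le> \<gamma>"
      using le[OF assms(11)] b(4) \<gamma>
      by (intro SO_dist_le_angle R_SO assms(11) t) (auto simp: F_def \<gamma>0_sq)
    moreover have "\<gamma> \<in> ?D"
      using \<gamma> by (intro memD) auto
    ultimately have "I \<gamma> \<le> influence I (R i_star t)"
      unfolding influence_def using monotone_onD[OF anti dom[OF assms(11)]] by blast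
    also have "\<dots> \<le> (\<Sum>j=1..N. influence I (R j t))"
      using assms(11) nonneg dom by (intro member_le_sum) (auto simp: influence_def simp del: of_nat_div)
    finally show ?thesis
      unfolding K_def using assms(6) N by (simp add: field_simps)
  qed
  have drift: "\<exists>D \<le> sqrt m * (mat_norm (\<Omega> i) - K / 2 * sqrt m). (F i has_real_derivative D) (at t)"
    if "0 < t" "\<And>l. l \<in> {1..N} \<Longrightarrow> F l t \<le> b l" "i \<in> {1..N}" "4 * (s i)\<^sup>2 \<le> m"
      "m \<le> F i t * (4 - F i t)" for t i m
    unfolding F_def
  proof (rule trace_defect_drift_le)
    show "K / 2 \<le> \<kappa> / 2 * (1 / real N * (\<Sum>j=1..N. influence I (R j t)))"
      using that by (intro coupling) auto
    show "0 \<le> m"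
      using that(4) zero_le_power2[of "s i"] by linarith
    have "2 * s i \<le> sqrt m"
      using that(4) by (intro real_le_rsqrt) (simp add: power_mult_distrib)
    then show "mat_norm (\<Omega> i) \<le> K / 2 * sqrt m"
      using K by (simp add: s_K)
    show "(R i has_vector_derivative \<Omega> i ** R i t +
        (\<kappa> / 2 * (1 / real N * (\<Sum>j=1..N. influence I (R j t)))) *\<^sub>R (mat 1 - R i t ** R i t)) (at t)"
      using assms(15) that by (simp add: winfree_solution_def)
  qed (use that skew R_SO K in \<open>auto simp: F_def\<close>)
  have drift_neg: "sqrt m * (mat_norm (\<Omega> i) - K / 2 * sqrt m) < 0" if "4 * (s i)\<^sup>2 < m" for i m
  proof -
    have "2 * s i < sqrt m"
      using that by (intro real_less_rsqrt) (simp add: power_mult_distrib)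
    moreover have "0 < m"
      using that zero_le_power2[of "s i"] by linarith
    ultimately show ?thesis
      using K by (intro mult_pos_neg) (auto simp: s_K)
  qed
  have below: "F i t < b i" if "i \<in> {1..N}" "0 \<le> t" for i t
  proof (rule barrier_invariance[where J = "{1..N}" and F = F])
    fix t j assume t: "0 < t" and le: "\<And>l. l \<in> {1..N} \<Longrightarrow> F l t \<le> b l" and j: "j \<in> {1..N}" "F j t = b j"
    obtain D where "D \<le> sqrt (b j * (4 - b j)) * (mat_norm (\<Omega> j) - K / 2 * sqrt (b j * (4 - b j)))"
      "(F j has_real_derivative D) (at t)"
      using drift[OF t le j(1) less_imp_le[OF b(3)[OF j(1)]]] j(2) by auto
    then show "\<exists>D<0. (F j has_real_derivative D) (at t)"
      using drift_neg[OF b(3)[OF j(1)]] order_le_less_trans by blast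
  qed (use that b cont in auto)
  have bound: "eventually (\<lambda>t. SO_dist (mat 1) (R i t) \<le> \<theta>) at_top"
    if i: "i \<in> {1..N}" and \<theta>: "arcsin (s i) < \<theta>" "\<theta> < pi / 2" for i \<theta>
  proof -
    have "0 \<le> arcsin (s i)"
      using s_nonneg[of i] s_less[OF i] arcsin_le_arcsin[of 0 "s i"] by simp
    have "sin (arcsin (s i)) < sin \<theta>"
      using \<theta> \<open>0 \<le> arcsin (s i)\<close> by (intro sin_monotone_2pi) auto
    then have "s i < sin \<theta>"
      using s_nonneg[of i] s_less[OF i] by simp
    define x where "x = 2 - 2 * cos \<theta>"
    have "4 * (s i)\<^sup>2 < x * (4 - x)"
      unfolding x_def double_angle_chord using \<open>s i < sin \<theta>\<close> s_nonneg by (simp add: power_strict_mono)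
    \<comment> \<open>While \<open>F i\<close> lies between \<open>x\<close> and its barrier,
      \<open>m\<close> bounds \<open>F i t * (4 - F i t)\<close> from below, so the decay rate is
      uniform in time.\<close>
    define m where "m = min (x * (4 - x)) (b i * (4 - b i))"
    have m: "4 * (s i)\<^sup>2 < m"
      using \<open>4 * (s i)\<^sup>2 < x * (4 - x)\<close> b(3)[OF i] by (simp add: m_def)
    have "eventually (\<lambda>t. F i t \<le> x) at_top"
    proof (rule eventually_below_of_decay)
      show "0 < - (sqrt m * (mat_norm (\<Omega> i) - K / 2 * sqrt m))"
        using drift_neg[OF m] by simp
      fix t :: real assume t: "0 < t" "x < F i t"
      have "m \<le> F i t * (4 - F i t)"
        unfolding m_def using t below[OF i, of t] by (intro chord_parabola_min_le) auto
      then show "\<exists>D\<le>- (- (sqrt m * (mat_norm (\<Omega> i) - K / 2 * sqrt m))). (F i has_real_derivative D) (at t)"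
        using drift[OF t(1) _ i] below m t(1) by (simp add: less_imp_le)
    qed (use cont F_nonneg i in auto)
    then show ?thesis
      using eventually_ge_at_top[of 0]
    proof eventually_elim
      case (elim t)
      then show ?case
        using \<theta> \<open>0 \<le> arcsin (s i)\<close> by (intro SO_dist_le_angle R_SO i) (auto simp: F_def x_def)
    qed
  qed
  show ?thesis
  proof
    fix i assume i: "i \<in> {1..N}"
    define a where "a = arcsin (s i)"
    have a: "0 \<le> a" "a < pi / 2"
      using s_nonneg[of i] s_less[OF i] arcsin_le_arcsin[of 0 "s i"] arcsin_lt_bounded[of "s i"]
      by (auto simp: a_def)
    \<comment> \<open>The argument yields the bound \<open>arcsin (s i)\<close>; the stated bound is
      weaker since \<open>sin (a / 2) \<le> a / 2\<close>. Each \<open>\<theta>\<close> slightly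
      above \<open>a\<close> is eventually an upper bound for the distance.\<close>
    have "Limsup at_top (\<lambda>t. ereal (SO_dist (mat 1) (R i t))) \<le> ereal a"
    proof (rule ereal_le_epsilon2)
      fix e :: real assume "0 < e"
      define \<theta> where "\<theta> = min (a + e) ((a + pi / 2) / 2)"
      have \<theta>: "a < \<theta>" "\<theta> < pi / 2" "\<theta> \<le> a + e"
        using a \<open>0 < e\<close> by (auto simp: \<theta>_def min_def)
      have "Limsup at_top (\<lambda>t. ereal (SO_dist (mat 1) (R i t))) \<le> ereal \<theta>"
        using bound[OF i, of \<theta>] \<theta> by (intro Limsup_bounded) (simp add: a_def)
      also have "\<dots> \<le> ereal a + ereal e"
        using \<theta> by simp
      finally show "Limsup at_top (\<lambda>t. ereal (SO_dist (mat 1) (R i t))) \<le> ereal a + ereal e" .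
    qed
    also have "a \<le> 2 * arcsin (1 / 2 * a)"
    proof -
      have "a / 2 = arcsin (sin (a / 2))"
        using a by (simp add: arcsin_sin)
      also have "\<dots> \<le> arcsin (a / 2)"
        using a sin_x_le_x[of "a / 2"] pi_less_4 by (intro arcsin_le_arcsin) auto
      finally show ?thesis
        by simp
    qed
    finally show "Limsup at_top (\<lambda>t. ereal (SO_dist (mat 1) (R i t)))
        \<le> ereal (2 * arcsin (1 / 2 * arcsin (real N * mat_norm (\<Omega> i) / (\<kappa> * I \<gamma>))))"
      by (simp add: a_def s_def)
  qed
qed

end
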